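(* Let $\mathcal{P}=(P_0\ltimes P_1,\{\,,\,\})$ be an admissible Poisson algebra whose corresponding Poisson triple is of the form $([\,,\,]_1=0,\mathcal{D},\mathcal{K})$. If the $d_{\mathcal{D}}$-cohomology class of the 2-cocycle $\Delta\mathcal{K}$ is trivial, then there is an isomorphism of $R$-modules $$\mathscr{H}^1(\mathcal{P})\simeq\mathrm{H}^1_{d_{\mathcal{D}}}(\mathfrak{X}^* )\oplus\frac{\widetilde{\mathfrak{M}}(\mathcal{P})}{\mathscr{C}(\mathcal{P})}\oplus\mathscr{E}(\mathcal{P}).$$
   Context: Let $R$ be a commutative ring with unit, $\mathcal{P}_0=(P_0,\cdot,\{\,,\,\}_0)$ a Poisson $R$-algebra (commutative associative unital $R$-algebra with an $R$-bilinear Lie bracket that is a derivation in each argument), $P_1$ a faithful $P_0$-module, and $P=P_0\ltimes P_1$ the $R$-module $P_0\oplus P_1$ with product $(f\oplus\eta)(g\oplus\xi)=fg\oplus(f\xi+g\eta)$. An admissible Poisson structure on $P$ is a Poisson structure with $\mathrm{pr}_0\{f\oplus\eta,g\oplus\xi\}=\{f,g\}_0$; $\mathcal{P}=(P,\{\,,\,\})$ is then an admissible Poisson algebra. $\Omega^1_{P_0}$ is the module of Kähler differentials of $P_0$ over $R$ with universal derivation $d$, anchor $\varrho_{P_0}(dh)=\{h,\cdot\}_0$ (extended $P_0$-linearly). A contravariant derivative on $P_1$ is an $R$-bilinear map $\mathcal{D}:\Omega^1_{P_0}\times P_1\to P_1$ with $\mathcal{D}_{f\alpha}\eta=f\mathcal{D}_\alpha\eta$,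 $\mathcal{D}_\alpha(f\eta)=f\mathcal{D}_\alpha\eta+\varrho_{P_0}(\alpha)(f)\eta$. Every admissible Poisson algebra has a unique corresponding Poisson triple $([\,,\,]_1,\mathcal{D},\mathcal{K})$, where $[\,,\,]_1$ is a $P_0$-linear Lie bracket on $P_1$, $\mathcal{D}$ a contravariant derivative on $P_1$, and $\mathcal{K}:\Omega^1_{P_0}\times\Omega^1_{P_0}\to P_1$ a $P_0$-bilinear skew-symmetric map, such that $\{f\oplus\eta,g\oplus\xi\}=\{f,g\}_0\oplus(\mathcal{D}_{df}\xi-\mathcal{D}_{dg}\eta+[\eta,\xi]_1+\mathcal{K}(df,dg))$. When $[\,,\,]_1=0$ the derivative $\mathcal{D}$ is flat. $\mathfrak{X}^k$ is the module of $R$-multilinear skew-symmetric maps $P_0^k\to P_1$ that are derivations in each argument ($\mathfrak{X}^0=P_1$), with differential $(d_{\mathcal{D}}Q)(f_0,\dots,f_k)=\sum_i(-1)^i\mathcal{D}_{df_i}(Q(\dots,\widehat{f_i},\dots))+\sum_{i<j}(-1)^{i+j}Q(\{f_i,f_j\}_0,f_0,\dots,\widehat{f_i},\dots,\widehat{f_j},\dots,f_k)$; in the present case $d_{\mathcal{D}}^2=0$, and $\mathrm{H}^1_{d_{\mathcal{D}}}(\mathfrak{X}^* )$ is the first cohomology. $\Delta\mathcal{K}\in\mathfrak{X}^2$ is $(\Delta\mathcal{K})(f,g)=\mathcal{K}(df,dg)$, a 2-cocycle. $\mathscr{H}^1(\mathcal{P})=\mathrm{Poiss}(\mathcal{P})/\mathrm{Ham}(\mathcal{P})$,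 where $\mathrm{Poiss}(\mathcal{P})$ is the set of derivations of the commutative algebra $P$ that are also derivations of $\{\,,\,\}$ and $\mathrm{Ham}(\mathcal{P})=\{\{\pi,\cdot\}\mid\pi\in P\}$; similarly $\mathrm{Poiss}(\mathcal{P}_0)$. $\widetilde{\mathfrak{M}}(\mathcal{P})$ is the set of $R$-linear maps $\mathscr{L}:P_1\to P_1$ for which there is $\ell\in\mathrm{Poiss}(\mathcal{P}_0)$ with $\mathscr{L}(f\eta)=f\mathscr{L}\eta+\ell(f)\eta$ and $\mathcal{D}_{df}\circ\mathscr{L}-\mathscr{L}\circ\mathcal{D}_{df}=-\mathcal{D}_{d\ell(f)}$ for all $f\in P_0,\eta\in P_1$. $\mathscr{C}(\mathcal{P})=\{\mathcal{D}_{df}\mid f\in P_0\}$. $\mathscr{E}(\mathcal{P})$ is the $R$-module of $P_0$-linear maps $T:P_1\to P_0$ with $T(\xi)\eta+T(\eta)\xi=0$, $T(\mathcal{D}_{df}\eta)=\{f,T\eta\}_0$, and $\mathcal{D}_{d(T\eta)}\xi=\mathcal{D}_{d(T\xi)}\eta$ for all $f\in P_0$, $\eta,\xi\in P_1$. *)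

theory Defs
  imports "HOL-Algebra.Module" "HOL-Algebra.AbelCoset"
begin

section \<open>Modules: homomorphisms, scalars, function modules, quotients, sums\<close>

definition module_hom ::
    "('r, 'x) ring_scheme \<Rightarrow> ('r, 'm) module \<Rightarrow> ('r, 'n) module \<Rightarrow> ('m \<Rightarrow> 'n) set" where
  "module_hom R M N = {h \<in> carrier M \<rightarrow> carrier N.
     (\<forall>x\<in>carrier M. \<forall>y\<in>carrier M. h (x \<oplus>\<^bsub>M\<^esub> y) = h x \<oplus>\<^bsub>N\<^esub> h y) \<and>
     (\<forall>r\<in>carrier R. \<forall>x\<in>carrier M. h (r \<odot>\<^bsub>M\<^esub> x) = r \<odot>\<^bsub>N\<^esub> h x)}"

definition module_isomorphic :: "('r, 'x) ring_scheme \<Rightarrow> ('r, 'm) module \<Rightarrow> ('r, 'n) module \<Rightarrow> bool" where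
  "module_isomorphic R M N \<longleftrightarrow> (\<exists>h\<in>module_hom R M N. bij_betw h (carrier M) (carrier N))"

definition module_bilinear ::
    "('r, 'x) ring_scheme \<Rightarrow> ('r, 'm) module \<Rightarrow> ('r, 'n) module \<Rightarrow> ('r, 'p) module \<Rightarrow> ('m \<Rightarrow> 'n \<Rightarrow> 'p) \<Rightarrow> bool" where
  "module_bilinear R M N Q b \<longleftrightarrow>
     (\<forall>x\<in>carrier M. b x \<in> module_hom R N Q) \<and>
     (\<forall>y\<in>carrier N. (\<lambda>x. b x y) \<in> module_hom R M Q)"

definition faithful_module :: "('r, 'x) ring_scheme \<Rightarrow> ('r, 'm) module \<Rightarrow> bool" where
  "faithful_module R M \<longleftrightarrow> module R M \<and>
     (\<forall>r\<in>carrier R. (\<forall>x\<in>carrier M. r \<odot>\<^bsub>M\<^esub> x = \<zero>\<^bsub>M\<^esub>) \<longrightarrow> r = \<zero>\<^bsub>R\<^esub>)"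

text \<open>The library's module record has ring multiplication fields, which are irrelevant for a
  module; below they are only filled in to obtain a value of that record type.\<close>

text \<open>An algebra regarded as a module over itself.\<close>

definition self_module :: "('r, 'a) module \<Rightarrow> ('a, 'a) module" where
  "self_module A = \<lparr>carrier = carrier A, mult = mult A, one = one A, zero = zero A, add = add A,
     smult = mult A\<rparr>"

text \<open>A module over an \<open>R\<close>-algebra \<open>A\<close>, regarded as an \<open>R\<close>-module along \<open>R \<rightarrow> A\<close>.\<close>

definition restrict_scalars :: "('r, 'a) module \<Rightarrow> ('a, 'm) module \<Rightarrow> ('r, 'm) module" where
  "restrict_scalars A M = \<lparr>carrier = carrier M, mult = mult M, one = one M, zero = zero M,
     add = add M, smult = (\<lambda>r x. (r \<odot>\<^bsub>A\<^esub> \<one>\<^bsub>A\<^esub>) \<odot>\<^bsub>M\<^esub> x)\<rparr>"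

text \<open>All maps \<open>S \<rightarrow> M\<close> with pointwise operations. Maps are extensional, so that equality of
  elements is equality on \<open>S\<close>. Modules of maps are obtained below by shrinking the carrier.\<close>

definition fun_module :: "'s set \<Rightarrow> ('r, 'm) module \<Rightarrow> ('r, 's \<Rightarrow> 'm) module" where
  "fun_module S M = \<lparr>carrier = S \<rightarrow>\<^sub>E carrier M,
     mult = (\<lambda>f g. \<lambda>s\<in>S. f s \<otimes>\<^bsub>M\<^esub> g s), one = (\<lambda>s\<in>S. \<one>\<^bsub>M\<^esub>),
     zero = (\<lambda>s\<in>S. \<zero>\<^bsub>M\<^esub>), add = (\<lambda>f g. \<lambda>s\<in>S. f s \<oplus>\<^bsub>M\<^esub> g s),
     smult = (\<lambda>r f. \<lambda>s\<in>S. r \<odot>\<^bsub>M\<^esub> f s)\<rparr>"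

definition quotient_module :: "('r, 'm) module \<Rightarrow> 'm set \<Rightarrow> ('r, 'm set) module" where
  "quotient_module M N = \<lparr>carrier = a_rcosets\<^bsub>M\<^esub> N, mult = undefined, one = undefined,
     zero = N, add = set_add M, smult = (\<lambda>r C. \<Union>x\<in>C. N +>\<^bsub>M\<^esub> (r \<odot>\<^bsub>M\<^esub> x))\<rparr>"

definition direct_sum_module ::
    "('r, 'm) module \<Rightarrow> ('r, 'n) module \<Rightarrow> ('r, 'm \<times> 'n) module" (infixr \<open>\<oplus>\<^bold>m\<close> 65) where
  "M \<oplus>\<^bold>m N = \<lparr>carrier = carrier M \<times> carrier N, mult = undefined, one = undefined,
     zero = (\<zero>\<^bsub>M\<^esub>, \<zero>\<^bsub>N\<^esub>), add = (\<lambda>(x, y) (x', y'). (x \<oplus>\<^bsub>M\<^esub> x', y \<oplus>\<^bsub>N\<^esub> y')),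
     smult = (\<lambda>r (x, y). (r \<odot>\<^bsub>M\<^esub> x, r \<odot>\<^bsub>N\<^esub> y))\<rparr>"

definition submodule_generated :: "('r, 'x) ring_scheme \<Rightarrow> ('r, 'm) module \<Rightarrow> 'm set \<Rightarrow> 'm set" where
  "submodule_generated R M X = \<Inter>{H. submodule H R M \<and> X \<subseteq> H}"


section \<open>Derivations and Poisson algebras\<close>

definition derivations ::
    "'r ring \<Rightarrow> ('r, 'a) module \<Rightarrow> ('a, 'm) module \<Rightarrow> ('a \<Rightarrow> 'm) set" where
  "derivations R A M = {X \<in> module_hom R A (restrict_scalars A M).
     \<forall>a\<in>carrier A. \<forall>b\<in>carrier A. X (a \<otimes>\<^bsub>A\<^esub> b) = a \<odot>\<^bsub>M\<^esub> X b \<oplus>\<^bsub>M\<^esub> b \<odot>\<^bsub>M\<^esub> X a}"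

text \<open>Lie brackets are alternating, as usual over a general commutative ring.\<close>

definition lie_bracket :: "('r, 'x) ring_scheme \<Rightarrow> ('r, 'm) module \<Rightarrow> ('m \<Rightarrow> 'm \<Rightarrow> 'm) \<Rightarrow> bool" where
  "lie_bracket R M b \<longleftrightarrow> module_bilinear R M M M b \<and>
     (\<forall>x\<in>carrier M. b x x = \<zero>\<^bsub>M\<^esub>) \<and>
     (\<forall>x\<in>carrier M. \<forall>y\<in>carrier M. \<forall>z\<in>carrier M.
        b x (b y z) \<oplus>\<^bsub>M\<^esub> b y (b z x) \<oplus>\<^bsub>M\<^esub> b z (b x y) = \<zero>\<^bsub>M\<^esub>)"

definition poisson_algebra :: "'r ring \<Rightarrow> ('r, 'a) module \<Rightarrow> ('a \<Rightarrow> 'a \<Rightarrow> 'a) \<Rightarrow> bool" where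
  "poisson_algebra R A br \<longleftrightarrow> algebra R A \<and> lie_bracket R A br \<and>
     (\<forall>f\<in>carrier A. br f \<in> derivations R A (self_module A)) \<and>
     (\<forall>g\<in>carrier A. (\<lambda>f. br f g) \<in> derivations R A (self_module A))"

definition Poiss :: "'r ring \<Rightarrow> ('r, 'a) module \<Rightarrow> ('a \<Rightarrow> 'a \<Rightarrow> 'a) \<Rightarrow> ('a \<Rightarrow> 'a) set" where
  "Poiss R A br = {X \<in> carrier A \<rightarrow>\<^sub>E carrier A. X \<in> derivations R A (self_module A) \<and>
     (\<forall>f\<in>carrier A. \<forall>g\<in>carrier A. X (br f g) = br (X f) g \<oplus>\<^bsub>A\<^esub> br f (X g))}"

definition Ham :: "('r, 'a) module \<Rightarrow> ('a \<Rightarrow> 'a \<Rightarrow> 'a) \<Rightarrow> ('a \<Rightarrow> 'a) set" where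
  "Ham A br = {\<lambda>x\<in>carrier A. br p x | p. p \<in> carrier A}"

definition poisson_H1 ::
    "'r ring \<Rightarrow> ('r, 'a) module \<Rightarrow> ('a \<Rightarrow> 'a \<Rightarrow> 'a) \<Rightarrow> ('r, ('a \<Rightarrow> 'a) set) module" where
  "poisson_H1 R A br =
     quotient_module ((fun_module (carrier A) A)\<lparr>carrier := Poiss R A br\<rparr>) (Ham A br)"


section \<open>Kaehler differentials\<close>

text \<open>The \<open>A\<close>-module of Kaehler differentials is the free \<open>A\<close>-module on symbols \<open>df\<close>, one for
  each \<open>f\<close> in \<open>A\<close>, modulo \<open>R\<close>-linearity and the Leibniz rule for \<open>d\<close>. Elements of the free
  module are finitely supported functions \<open>A \<rightarrow> A\<close>.\<close>

definition free_module :: "('r, 'a) module \<Rightarrow> ('a, 'a \<Rightarrow> 'a) module" where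
  "free_module A = (fun_module (carrier A) (self_module A))
     \<lparr>carrier := {\<phi> \<in> carrier A \<rightarrow>\<^sub>E carrier A. finite {h \<in> carrier A. \<phi> h \<noteq> \<zero>\<^bsub>A\<^esub>}}\<rparr>"

definition free_gen :: "('r, 'a) module \<Rightarrow> 'a \<Rightarrow> 'a \<Rightarrow> 'a" where
  "free_gen A f = (\<lambda>h\<in>carrier A. if h = f then \<one>\<^bsub>A\<^esub> else \<zero>\<^bsub>A\<^esub>)"

definition kaehler_relations :: "'r ring \<Rightarrow> ('r, 'a) module \<Rightarrow> ('a \<Rightarrow> 'a) set" where
  "kaehler_relations R A = (let F = free_module A; \<delta> = free_gen A in
     submodule_generated A F
       ({\<delta> (f \<oplus>\<^bsub>A\<^esub> g) \<ominus>\<^bsub>F\<^esub> (\<delta> f \<oplus>\<^bsub>F\<^esub> \<delta> g) | f g. f \<in> carrier A \<and> g \<in> carrier A} \<union>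
        {\<delta> (r \<odot>\<^bsub>A\<^esub> f) \<ominus>\<^bsub>F\<^esub> (r \<odot>\<^bsub>A\<^esub> \<one>\<^bsub>A\<^esub>) \<odot>\<^bsub>F\<^esub> \<delta> f | r f. r \<in> carrier R \<and> f \<in> carrier A} \<union>
        {\<delta> (f \<otimes>\<^bsub>A\<^esub> g) \<ominus>\<^bsub>F\<^esub> (f \<odot>\<^bsub>F\<^esub> \<delta> g \<oplus>\<^bsub>F\<^esub> g \<odot>\<^bsub>F\<^esub> \<delta> f) | f g. f \<in> carrier A \<and> g \<in> carrier A}))"

definition kaehler :: "'r ring \<Rightarrow> ('r, 'a) module \<Rightarrow> ('a, ('a \<Rightarrow> 'a) set) module" where
  "kaehler R A = quotient_module (free_module A) (kaehler_relations R A)"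

definition kaehler_d :: "'r ring \<Rightarrow> ('r, 'a) module \<Rightarrow> 'a \<Rightarrow> ('a \<Rightarrow> 'a) set" where
  "kaehler_d R A f = kaehler_relations R A +>\<^bsub>free_module A\<^esub> free_gen A f"

text \<open>The \<open>A\<close>-linear map on Kaehler differentials induced by a derivation \<open>\<delta>\<close>, i.e. the one
  with \<open>dh \<mapsto> \<delta> h\<close>: it sends the class of \<open>\<phi>\<close> to \<open>\<Sum>\<^sub>h \<phi>(h) \<delta>(h)\<close>.\<close>

definition kaehler_lift ::
    "('r, 'a) module \<Rightarrow> ('a, 'm) module \<Rightarrow> ('a \<Rightarrow> 'm) \<Rightarrow> ('a \<Rightarrow> 'a) set \<Rightarrow> 'm" where
  "kaehler_lift A M \<delta> \<alpha> = (THE y. \<exists>\<phi>\<in>\<alpha>.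
     y = (\<Oplus>\<^bsub>M\<^esub>h\<in>{h \<in> carrier A. \<phi> h \<noteq> \<zero>\<^bsub>A\<^esub>}. \<phi> h \<odot>\<^bsub>M\<^esub> \<delta> h))"

definition anchor ::
    "('r, 'a) module \<Rightarrow> ('a \<Rightarrow> 'a \<Rightarrow> 'a) \<Rightarrow> ('a \<Rightarrow> 'a) set \<Rightarrow> 'a \<Rightarrow> 'a" where
  "anchor A br \<alpha> f = kaehler_lift A (self_module A) (\<lambda>h. br h f) \<alpha>"


section \<open>Admissible Poisson algebras and Poisson triples\<close>

definition semidirect :: "('r, 'a) module \<Rightarrow> ('a, 'b) module \<Rightarrow> ('r, 'a \<times> 'b) module"
    (infixl \<open>\<ltimes>\<close> 70) where
  "A \<ltimes> M = \<lparr>carrier = carrier A \<times> carrier M,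
     mult = (\<lambda>(f, \<eta>) (g, \<xi>). (f \<otimes>\<^bsub>A\<^esub> g, f \<odot>\<^bsub>M\<^esub> \<xi> \<oplus>\<^bsub>M\<^esub> g \<odot>\<^bsub>M\<^esub> \<eta>)),
     one = (\<one>\<^bsub>A\<^esub>, \<zero>\<^bsub>M\<^esub>), zero = (\<zero>\<^bsub>A\<^esub>, \<zero>\<^bsub>M\<^esub>),
     add = (\<lambda>(f, \<eta>) (g, \<xi>). (f \<oplus>\<^bsub>A\<^esub> g, \<eta> \<oplus>\<^bsub>M\<^esub> \<xi>)),
     smult = (\<lambda>r (f, \<eta>). (r \<odot>\<^bsub>A\<^esub> f, r \<odot>\<^bsub>restrict_scalars A M\<^esub> \<eta>))\<rparr>"

text \<open>The admissible Poisson algebra includes its data: the Poisson algebra \<open>P0\<close> and the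
  faithful \<open>P0\<close>-module \<open>P1\<close>.\<close>

definition admissible_poisson_algebra ::
    "'r ring \<Rightarrow> ('r, 'a) module \<Rightarrow> ('a \<Rightarrow> 'a \<Rightarrow> 'a) \<Rightarrow> ('a, 'b) module \<Rightarrow>
     ('a \<times> 'b \<Rightarrow> 'a \<times> 'b \<Rightarrow> 'a \<times> 'b) \<Rightarrow> bool" where
  "admissible_poisson_algebra R P0 br0 P1 br \<longleftrightarrow>
     poisson_algebra R P0 br0 \<and> faithful_module P0 P1 \<and>
     poisson_algebra R (P0 \<ltimes> P1) br \<and>
     (\<forall>x\<in>carrier (P0 \<ltimes> P1). \<forall>y\<in>carrier (P0 \<ltimes> P1). fst (br x y) = br0 (fst x) (fst y))"

definition contravariant_derivative ::
    "'r ring \<Rightarrow> ('r, 'a) module \<Rightarrow> ('a \<Rightarrow> 'a \<Rightarrow> 'a) \<Rightarrow> ('a, 'b) module \<Rightarrow>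
     (('a \<Rightarrow> 'a) set \<Rightarrow> 'b \<Rightarrow> 'b) \<Rightarrow> bool" where
  "contravariant_derivative R P0 br0 P1 D \<longleftrightarrow>
     module_bilinear R (restrict_scalars P0 (kaehler R P0)) (restrict_scalars P0 P1)
       (restrict_scalars P0 P1) D \<and>
     (\<forall>f\<in>carrier P0. \<forall>\<alpha>\<in>carrier (kaehler R P0). \<forall>\<eta>\<in>carrier P1.
        D (f \<odot>\<^bsub>kaehler R P0\<^esub> \<alpha>) \<eta> = f \<odot>\<^bsub>P1\<^esub> D \<alpha> \<eta> \<and>
        D \<alpha> (f \<odot>\<^bsub>P1\<^esub> \<eta>) = f \<odot>\<^bsub>P1\<^esub> D \<alpha> \<eta> \<oplus>\<^bsub>P1\<^esub> anchor P0 br0 \<alpha> f \<odot>\<^bsub>P1\<^esub> \<eta>)"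

definition corresponding_triple ::
    "'r ring \<Rightarrow> ('r, 'a) module \<Rightarrow> ('a \<Rightarrow> 'a \<Rightarrow> 'a) \<Rightarrow> ('a, 'b) module \<Rightarrow>
     ('a \<times> 'b \<Rightarrow> 'a \<times> 'b \<Rightarrow> 'a \<times> 'b) \<Rightarrow> ('b \<Rightarrow> 'b \<Rightarrow> 'b) \<Rightarrow>
     (('a \<Rightarrow> 'a) set \<Rightarrow> 'b \<Rightarrow> 'b) \<Rightarrow> (('a \<Rightarrow> 'a) set \<Rightarrow> ('a \<Rightarrow> 'a) set \<Rightarrow> 'b) \<Rightarrow> bool" where
  "corresponding_triple R P0 br0 P1 br br1 D K \<longleftrightarrow>
     lie_bracket P0 P1 br1 \<and>
     contravariant_derivative R P0 br0 P1 D \<and>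
     module_bilinear P0 (kaehler R P0) (kaehler R P0) P1 K \<and>
     (\<forall>\<alpha>\<in>carrier (kaehler R P0). \<forall>\<beta>\<in>carrier (kaehler R P0). K \<alpha> \<beta> = \<ominus>\<^bsub>P1\<^esub> K \<beta> \<alpha>) \<and>
     (\<forall>f\<in>carrier P0. \<forall>\<eta>\<in>carrier P1. \<forall>g\<in>carrier P0. \<forall>\<xi>\<in>carrier P1.
        br (f, \<eta>) (g, \<xi>) =
          (br0 f g, (D (kaehler_d R P0 f) \<xi> \<ominus>\<^bsub>P1\<^esub> D (kaehler_d R P0 g) \<eta>) \<oplus>\<^bsub>P1\<^esub> br1 \<eta> \<xi>
                    \<oplus>\<^bsub>P1\<^esub> K (kaehler_d R P0 f) (kaehler_d R P0 g)))"


section \<open>The complex of skew-symmetric multiderivations\<close>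

text \<open>\<open>k\<close>-tuples are lists of length \<open>k\<close>. For \<open>k = 0\<close> the only tuple is the empty list, so a
  \<open>0\<close>-cochain is an element of \<open>P1\<close>.\<close>

definition tuples :: "('r, 'a) module \<Rightarrow> nat \<Rightarrow> 'a list set" where
  "tuples A k = {fs. length fs = k \<and> set fs \<subseteq> carrier A}"

definition omit_nth :: "nat \<Rightarrow> 'a list \<Rightarrow> 'a list" where
  "omit_nth i fs = take i fs @ drop (Suc i) fs"

definition multiderivations ::
    "'r ring \<Rightarrow> ('r, 'a) module \<Rightarrow> ('a, 'b) module \<Rightarrow> nat \<Rightarrow> ('r, 'a list \<Rightarrow> 'b) module" where
  "multiderivations R A M k = (fun_module (tuples A k) (restrict_scalars A M))
     \<lparr>carrier := {Q \<in> tuples A k \<rightarrow>\<^sub>E carrier M.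
        (\<forall>fs\<in>tuples A k. \<forall>i<k. (\<lambda>f. Q (fs[i := f])) \<in> derivations R A M) \<and>
        (\<forall>fs\<in>tuples A k. \<forall>i<k. \<forall>j<k. i \<noteq> j \<longrightarrow>
           Q (fs[i := fs ! j, j := fs ! i]) = \<ominus>\<^bsub>M\<^esub> Q fs)}\<rparr>"

definition differential ::
    "'r ring \<Rightarrow> ('r, 'a) module \<Rightarrow> ('a \<Rightarrow> 'a \<Rightarrow> 'a) \<Rightarrow> ('a, 'b) module \<Rightarrow>
     (('a \<Rightarrow> 'a) set \<Rightarrow> 'b \<Rightarrow> 'b) \<Rightarrow> nat \<Rightarrow> ('a list \<Rightarrow> 'b) \<Rightarrow> 'a list \<Rightarrow> 'b" where
  "differential R P0 br0 P1 D k Q = (\<lambda>fs\<in>tuples P0 (Suc k).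
     (\<Oplus>\<^bsub>P1\<^esub>i\<in>{..k}. [((- 1 :: int) ^ i)] \<cdot>\<^bsub>P1\<^esub>
        (D (kaehler_d R P0 (fs ! i)) (Q (omit_nth i fs))))
     \<oplus>\<^bsub>P1\<^esub>
     (\<Oplus>\<^bsub>P1\<^esub>p\<in>{(i, j). i < j \<and> j \<le> k}. [((- 1 :: int) ^ (fst p + snd p))] \<cdot>\<^bsub>P1\<^esub>
        (Q (br0 (fs ! fst p) (fs ! snd p) # omit_nth (fst p) (omit_nth (snd p) fs)))))"

definition cocycles ::
    "'r ring \<Rightarrow> ('r, 'a) module \<Rightarrow> ('a \<Rightarrow> 'a \<Rightarrow> 'a) \<Rightarrow> ('a, 'b) module \<Rightarrow>
     (('a \<Rightarrow> 'a) set \<Rightarrow> 'b \<Rightarrow> 'b) \<Rightarrow> nat \<Rightarrow> ('r, 'a list \<Rightarrow> 'b) module" where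
  "cocycles R P0 br0 P1 D k = (multiderivations R P0 P1 k)
     \<lparr>carrier := {Q \<in> carrier (multiderivations R P0 P1 k).
        differential R P0 br0 P1 D k Q = \<zero>\<^bsub>multiderivations R P0 P1 (Suc k)\<^esub>}\<rparr>"

fun coboundaries ::
    "'r ring \<Rightarrow> ('r, 'a) module \<Rightarrow> ('a \<Rightarrow> 'a \<Rightarrow> 'a) \<Rightarrow> ('a, 'b) module \<Rightarrow>
     (('a \<Rightarrow> 'a) set \<Rightarrow> 'b \<Rightarrow> 'b) \<Rightarrow> nat \<Rightarrow> ('a list \<Rightarrow> 'b) set" where
  "coboundaries R P0 br0 P1 D 0 = {\<zero>\<^bsub>multiderivations R P0 P1 0\<^esub>}"
| "coboundaries R P0 br0 P1 D (Suc k) =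
     differential R P0 br0 P1 D k ` carrier (multiderivations R P0 P1 k)"

definition cohomology ::
    "'r ring \<Rightarrow> ('r, 'a) module \<Rightarrow> ('a \<Rightarrow> 'a \<Rightarrow> 'a) \<Rightarrow> ('a, 'b) module \<Rightarrow>
     (('a \<Rightarrow> 'a) set \<Rightarrow> 'b \<Rightarrow> 'b) \<Rightarrow> nat \<Rightarrow> ('r, ('a list \<Rightarrow> 'b) set) module" where
  "cohomology R P0 br0 P1 D k =
     quotient_module (cocycles R P0 br0 P1 D k) (coboundaries R P0 br0 P1 D k)"

definition cohomology_class ::
    "'r ring \<Rightarrow> ('r, 'a) module \<Rightarrow> ('a \<Rightarrow> 'a \<Rightarrow> 'a) \<Rightarrow> ('a, 'b) module \<Rightarrow>
     (('a \<Rightarrow> 'a) set \<Rightarrow> 'b \<Rightarrow> 'b) \<Rightarrow> nat \<Rightarrow> ('a list \<Rightarrow> 'b) \<Rightarrow> ('a list \<Rightarrow> 'b) set" where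
  "cohomology_class R P0 br0 P1 D k Q =
     coboundaries R P0 br0 P1 D k +>\<^bsub>cocycles R P0 br0 P1 D k\<^esub> Q"

definition Delta ::
    "'r ring \<Rightarrow> ('r, 'a) module \<Rightarrow> (('a \<Rightarrow> 'a) set \<Rightarrow> ('a \<Rightarrow> 'a) set \<Rightarrow> 'b) \<Rightarrow> 'a list \<Rightarrow> 'b" where
  "Delta R P0 K = (\<lambda>fs\<in>tuples P0 2. K (kaehler_d R P0 (fs ! 0)) (kaehler_d R P0 (fs ! 1)))"


section \<open>The remaining two summands\<close>

definition M_tilde ::
    "'r ring \<Rightarrow> ('r, 'a) module \<Rightarrow> ('a \<Rightarrow> 'a \<Rightarrow> 'a) \<Rightarrow> ('a, 'b) module \<Rightarrow>
     (('a \<Rightarrow> 'a) set \<Rightarrow> 'b \<Rightarrow> 'b) \<Rightarrow> ('r, 'b \<Rightarrow> 'b) module" where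
  "M_tilde R P0 br0 P1 D = (fun_module (carrier P1) (restrict_scalars P0 P1))
     \<lparr>carrier := {L \<in> carrier P1 \<rightarrow>\<^sub>E carrier P1.
        L \<in> module_hom R (restrict_scalars P0 P1) (restrict_scalars P0 P1) \<and>
        (\<exists>l\<in>Poiss R P0 br0. \<forall>f\<in>carrier P0. \<forall>\<eta>\<in>carrier P1.
           L (f \<odot>\<^bsub>P1\<^esub> \<eta>) = f \<odot>\<^bsub>P1\<^esub> L \<eta> \<oplus>\<^bsub>P1\<^esub> l f \<odot>\<^bsub>P1\<^esub> \<eta> \<and>
           D (kaehler_d R P0 f) (L \<eta>) \<ominus>\<^bsub>P1\<^esub> L (D (kaehler_d R P0 f) \<eta>) =
             \<ominus>\<^bsub>P1\<^esub> D (kaehler_d R P0 (l f)) \<eta>)}\<rparr>"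

definition C_inner ::
    "'r ring \<Rightarrow> ('r, 'a) module \<Rightarrow> ('a, 'b) module \<Rightarrow>
     (('a \<Rightarrow> 'a) set \<Rightarrow> 'b \<Rightarrow> 'b) \<Rightarrow> ('b \<Rightarrow> 'b) set" where
  "C_inner R P0 P1 D = {\<lambda>\<eta>\<in>carrier P1. D (kaehler_d R P0 f) \<eta> | f. f \<in> carrier P0}"

definition E_module ::
    "'r ring \<Rightarrow> ('r, 'a) module \<Rightarrow> ('a \<Rightarrow> 'a \<Rightarrow> 'a) \<Rightarrow> ('a, 'b) module \<Rightarrow>
     (('a \<Rightarrow> 'a) set \<Rightarrow> 'b \<Rightarrow> 'b) \<Rightarrow> ('r, 'b \<Rightarrow> 'a) module" where
  "E_module R P0 br0 P1 D = (fun_module (carrier P1) P0)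
     \<lparr>carrier := {T \<in> carrier P1 \<rightarrow>\<^sub>E carrier P0.
        T \<in> module_hom P0 P1 (self_module P0) \<and>
        (\<forall>\<eta>\<in>carrier P1. \<forall>\<xi>\<in>carrier P1. T \<xi> \<odot>\<^bsub>P1\<^esub> \<eta> \<oplus>\<^bsub>P1\<^esub> T \<eta> \<odot>\<^bsub>P1\<^esub> \<xi> = \<zero>\<^bsub>P1\<^esub>) \<and>
        (\<forall>f\<in>carrier P0. \<forall>\<eta>\<in>carrier P1. T (D (kaehler_d R P0 f) \<eta>) = br0 f (T \<eta>)) \<and>
        (\<forall>\<eta>\<in>carrier P1. \<forall>\<xi>\<in>carrier P1.
           D (kaehler_d R P0 (T \<eta>)) \<xi> = D (kaehler_d R P0 (T \<xi>)) \<eta>)}\<rparr>"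

end

theory Submission
  imports Defs
begin

text \<open>
  If \<open>\<Delta>K = d\<^sub>D Q\<close>, the algebra automorphism \<open>(f, \<eta>) \<mapsto> (f, \<eta> + Q f)\<close> carries the bracket to the one
  with \<open>K = 0\<close>, and conjugation by it identifies the first Poisson cohomologies. For \<open>K = 0\<close>, an
  \<open>R\<close>-linear map has the form \<open>X(f, \<eta>) = (l f + T \<eta>, q f + L \<eta>)\<close>, and evaluating the Leibniz rule
  and the compatibility with the bracket on pairs of elements \<open>(f, 0)\<close>, \<open>(0, \<eta>)\<close> shows that \<open>X\<close> is a
  Poisson derivation iff \<open>q\<close> is a 1-cocycle, \<open>L\<close> lies in \<open>M_tilde\<close> with symbol \<open>l\<close>, and \<open>T\<close> lies
  in \<open>E_module\<close>. Since \<open>P1\<close> is faithful, \<open>L\<close> determines \<open>l\<close>. The Hamiltonian derivation of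
  \<open>(g, \<xi>)\<close> has components \<open>q = - d\<^sub>D \<xi>\<close>, \<open>L = D\<^bsub>dg\<^esub>\<close> and \<open>T = 0\<close>.
\<close>

section \<open>Modules and their quotients\<close>

text \<open>The symbol \<open>l\<close> has no summand of its own: faithfulness makes it a function
  of \<open>L\<close>, so \<open>L\<close> alone records the pair. The quotient is a direct sum
  because the Hamiltonian derivations fill out a product. For (g, \<xi>), the element \<xi> is seen
  only by \<open>q\<close>, and g only by \<open>L\<close> and \<open>l\<close>, where the value {g,
  .}_0 of \<open>l\<close> is again forced by \<open>L\<close>. A Poisson derivation is therefore
  Hamiltonian exactly if its components lie in the coboundaries, in \<open>C_inner\<close> and in
  zero. The passage to K = 0 is what separates the components. With K, the bracket of (f, 0) and (g,
  0) has K(df, dg) in its P1-part, so compatibility on such a pair would tie \<open>q\<close> to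
  \<open>L\<close> and \<open>l\<close>, and \<open>l\<close> to \<open>T\<close>. The module laws
  for cocycles, \<open>M_tilde\<close> and \<open>E_module\<close> are not checked one by one: each
  is the image of the module of Poisson derivations under a component map, and the laws pass to
  images.\<close>

lemma (in abelian_group) diff_eq_zero_iff:
  assumes "x \<in> carrier G" "y \<in> carrier G"
  shows "x \<ominus> y = \<zero> \<longleftrightarrow> x = y"
  using assms by (metis a_minus_def minus_closed minus_equality minus_minus a_inv_closed r_neg)

lemma (in abelian_group) minus_zero_eq [simp]: "\<ominus> \<zero> = \<zero>"
  by (rule minus_equality) auto

text \<open>The cancellation that removes K. It is applied with u = D_df \<xi>, a = D_df(q g), v =
  D_dg \<eta>, b = D_dg(q f) and c = q {f, g}_0, for which \<open>a \<ominus> b \<ominus> c\<close>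
  is (d_D q)(f, g) = K(df, dg).\<close>

lemma (in abelian_group) cancel_shift:
  assumes "u \<in> carrier G" "a \<in> carrier G" "v \<in> carrier G" "b \<in> carrier G" "c \<in> carrier G"
  shows "(u \<ominus> a) \<ominus> (v \<ominus> b) \<oplus> (a \<ominus> b \<ominus> c) \<oplus> c = u \<ominus> v"
proof -
  have "(u \<ominus> a) \<ominus> (v \<ominus> b) \<oplus> (a \<ominus> b \<ominus> c) \<oplus> c =
    (u \<ominus> v) \<oplus> ((a \<oplus> \<ominus> a) \<oplus> ((b \<oplus> \<ominus> b) \<oplus> (c \<oplus> \<ominus> c)))"
    using assms by (simp add: a_minus_def minus_add a_ac del: r_neg1 r_neg2)
  then show ?thesis
    using assms by (simp add: r_neg)
qed

lemma module_homI:
  assumes "\<And>x. x \<in> carrier M \<Longrightarrow> h x \<in> carrier N"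
    and "\<And>x y. x \<in> carrier M \<Longrightarrow> y \<in> carrier M \<Longrightarrow> h (x \<oplus>\<^bsub>M\<^esub> y) = h x \<oplus>\<^bsub>N\<^esub> h y"
    and "\<And>r x. r \<in> carrier R \<Longrightarrow> x \<in> carrier M \<Longrightarrow> h (r \<odot>\<^bsub>M\<^esub> x) = r \<odot>\<^bsub>N\<^esub> h x"
  shows "h \<in> module_hom R M N"
  using assms by (auto simp: module_hom_def)

lemma module_homD:
  assumes "h \<in> module_hom R M N"
  shows "\<And>x. x \<in> carrier M \<Longrightarrow> h x \<in> carrier N"
    and "\<And>x y. x \<in> carrier M \<Longrightarrow> y \<in> carrier M \<Longrightarrow> h (x \<oplus>\<^bsub>M\<^esub> y) = h x \<oplus>\<^bsub>N\<^esub> h y"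
    and "\<And>r x. r \<in> carrier R \<Longrightarrow> x \<in> carrier M \<Longrightarrow> h (r \<odot>\<^bsub>M\<^esub> x) = r \<odot>\<^bsub>N\<^esub> h x"
  using assms by (auto simp: module_hom_def)

lemma module_hom_zero:
  assumes "h \<in> module_hom R M N" "module R M" "module R N"
  shows "h \<zero>\<^bsub>M\<^esub> = \<zero>\<^bsub>N\<^esub>"
proof -
  interpret M: module R M by fact
  interpret N: module R N by fact
  have "h (\<zero>\<^bsub>R\<^esub> \<odot>\<^bsub>M\<^esub> \<zero>\<^bsub>M\<^esub>) = \<zero>\<^bsub>R\<^esub> \<odot>\<^bsub>N\<^esub> h \<zero>\<^bsub>M\<^esub>"
    using module_homD(3)[OF assms(1)] by blast
  then show ?thesis
    using module_homD(1)[OF assms(1)] by simp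
qed

lemma module_hom_minus:
  assumes "h \<in> module_hom R M N" "module R M" "module R N" "x \<in> carrier M"
  shows "h (\<ominus>\<^bsub>M\<^esub> x) = \<ominus>\<^bsub>N\<^esub> h x"
proof -
  interpret M: module R M by fact
  interpret N: module R N by fact
  note h = module_homD[OF assms(1)]
  have "h (\<ominus>\<^bsub>M\<^esub> x) \<oplus>\<^bsub>N\<^esub> h x = \<zero>\<^bsub>N\<^esub>"
    using h(2)[of "\<ominus>\<^bsub>M\<^esub> x" x] assms(4) module_hom_zero[OF assms(1-3)] by (simp add: M.l_neg)
  then show ?thesis
    using h(1) assms(4) by (metis M.a_inv_closed N.minus_equality)
qed

lemma module_hom_diff:
  assumes "h \<in> module_hom R M N" "module R M" "module R N" "x \<in> carrier M" "y \<in> carrier M"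
  shows "h (x \<ominus>\<^bsub>M\<^esub> y) = h x \<ominus>\<^bsub>N\<^esub> h y"
proof -
  interpret M: module R M by fact
  show ?thesis
    using assms module_homD(2)[OF assms(1)] module_hom_minus[OF assms(1-3)]
    by (simp add: a_minus_def)
qed

text \<open>Equational laws pass to surjective images, and inverses are images of inverses. The
  value at zero is a separate hypothesis because \<open>module_hom\<close> speaks only of addition
  and scalars, and \<open>N\<close> is not yet known to have a neutral element.\<close>

lemma module_of_surjective_hom:
  assumes "module R M" "h \<in> module_hom R M N" "carrier N \<subseteq> h ` carrier M" "h \<zero>\<^bsub>M\<^esub> = \<zero>\<^bsub>N\<^esub>"
  shows "module R N"
proof -
  interpret module R M by fact
  note h = module_homD[OF assms(2)]
  have c: "carrier N = h ` carrier M"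
    using assms(3) h(1) by auto
  have "abelian_group N"
  proof (rule abelian_groupI)
    show "\<exists>y\<in>carrier N. y \<oplus>\<^bsub>N\<^esub> x = \<zero>\<^bsub>N\<^esub>" if x: "x \<in> carrier N" for x
    proof -
      obtain u where u: "u \<in> carrier M" "x = h u"
        using x c by auto
      then have "h (\<ominus>\<^bsub>M\<^esub> u) \<oplus>\<^bsub>N\<^esub> x = \<zero>\<^bsub>N\<^esub>"
        using h(2)[of "\<ominus>\<^bsub>M\<^esub> u" u] assms(4) by (simp add: M.l_neg)
      then show ?thesis
        using u c by blast
    qed
    show "\<zero>\<^bsub>N\<^esub> \<in> carrier N"
      using assms(4) h(1) by (metis M.zero_closed)
    show "\<zero>\<^bsub>N\<^esub> \<oplus>\<^bsub>N\<^esub> x = x" if "x \<in> carrier N" for x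
      using that unfolding c assms(4)[symmetric] by (auto simp: h(2)[symmetric])
  qed (auto simp: c h(2)[symmetric] M.a_ac)
  then show ?thesis
    by (rule moduleI[OF R.is_cring])
      (auto simp: c h(2,3)[symmetric] smult_l_distr smult_r_distr smult_assoc1)
qed

lemma submodule_image:
  assumes "module R M" "module R N" "h \<in> module_hom R M N" "submodule H R M"
  shows "submodule (h ` H) R N"
proof -
  interpret M: module R M by fact
  interpret N: module R N by fact
  note h = module_homD[OF assms(3)]
  note H = M.submoduleE[OF assms(4)]
  have Hc: "x \<in> carrier M" if "x \<in> H" for x
    using H(1) that by auto
  show ?thesis
  proof (rule N.submoduleI)
    have "\<zero>\<^bsub>M\<^esub> \<in> H"
      using H(2,3,5) by (metis Hc M.r_neg ex_in_conv)
    then show "\<zero>\<^bsub>N\<^esub> \<in> h ` H"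
      using module_hom_zero[OF assms(3,1,2)] by force
    show "\<ominus>\<^bsub>N\<^esub> a \<in> h ` H" if "a \<in> h ` H" for a
      using that H(3) module_hom_minus[OF assms(3,1,2)] Hc by force
    show "a \<oplus>\<^bsub>N\<^esub> b \<in> h ` H" if "a \<in> h ` H" "b \<in> h ` H" for a b
      using that H(5) h(2) Hc by (smt (verit) imageE imageI)
    show "r \<odot>\<^bsub>N\<^esub> a \<in> h ` H" if "r \<in> carrier R" "a \<in> h ` H" for r a
      using that H(4) h(3) Hc by (smt (verit) imageE imageI)
  qed (use h(1) Hc in auto)
qed

text \<open>Both \<open>N\<close> and \<open>T\<close> are \<open>M\<close> modulo the same
  equivalence relation, so sending p x to g x is well defined and bijective; the choice of a
  preimage under \<open>p\<close> is immaterial. It is used with the coset map as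
  \<open>p\<close>.\<close>

lemma module_isomorphic_of_same_fibres:
  assumes "module R M"
    and p: "p \<in> module_hom R M N" "carrier N \<subseteq> p ` carrier M"
    and g: "g \<in> module_hom R M T" "carrier T \<subseteq> g ` carrier M"
    and fib: "\<And>x y. x \<in> carrier M \<Longrightarrow> y \<in> carrier M \<Longrightarrow> p x = p y \<longleftrightarrow> g x = g y"
  shows "module_isomorphic R N T"
proof -
  interpret M: module R M by fact
  note P = module_homD[OF p(1)] and G = module_homD[OF g(1)]
  define h where "h c = g (inv_into (carrier M) p c)" for c
  have h: "h (p x) = g x" if "x \<in> carrier M" for x
    using that unfolding h_def
    by (metis fib f_inv_into_f image_eqI inv_into_into)
  have c: "carrier N = p ` carrier M"
    using p(2) P(1) by auto
  have "h \<in> module_hom R N T"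
    by (rule module_homI) (auto simp: c h G P(2,3)[symmetric])
  moreover have "bij_betw h (carrier N) (carrier T)"
    unfolding bij_betw_def inj_on_def c using g(2) G(1) fib by (auto simp: h image_iff) (metis image_iff subsetD)
  ultimately show ?thesis
    unfolding module_isomorphic_def by blast
qed

section \<open>Cosets, modules of maps and quotients that split as direct sums\<close>

lemma coset_eq_iff:
  assumes "module R M" "submodule H R M" "x \<in> carrier M" "y \<in> carrier M"
  shows "H +>\<^bsub>M\<^esub> x = H +>\<^bsub>M\<^esub> y \<longleftrightarrow> x \<ominus>\<^bsub>M\<^esub> y \<in> H"
proof -
  interpret module R M by fact
  interpret H: submodule H R M by fact
  interpret abelian_subgroup H M
    by (intro abelian_subgroupI3 additive_subgroupI H.subgroup_axioms M.abelian_group_axioms)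
  show ?thesis
    using assms(3,4) a_repr_independence' a_repr_independenceD a_rcos_module
    by (metis a_minus_def)
qed

lemma coset_map_hom:
  assumes "module R M" "submodule H R M"
  shows "(\<lambda>x. H +>\<^bsub>M\<^esub> x) \<in> module_hom R M (quotient_module M H)"
    and "carrier (quotient_module M H) \<subseteq> (\<lambda>x. H +>\<^bsub>M\<^esub> x) ` carrier M"
    and "H +>\<^bsub>M\<^esub> \<zero>\<^bsub>M\<^esub> = \<zero>\<^bsub>quotient_module M H\<^esub>"
proof -
  interpret module R M by fact
  interpret H: submodule H R M by fact
  interpret abelian_subgroup H M
    by (intro abelian_subgroupI3 additive_subgroupI H.subgroup_axioms M.abelian_group_axioms)
  show "carrier (quotient_module M H) \<subseteq> (\<lambda>x. H +>\<^bsub>M\<^esub> x) ` carrier M"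
    by (auto simp: quotient_module_def A_RCOSETS_def')
  show "H +>\<^bsub>M\<^esub> \<zero>\<^bsub>M\<^esub> = \<zero>\<^bsub>quotient_module M H\<^esub>"
    using a_subset by (simp add: quotient_module_def)
  \<comment> \<open>Scalar multiplication of cosets is a union over all representatives. Two of them
    differ by some h in \<open>H\<close>, and r h is again in \<open>H\<close>, so all contribute
    the same coset.\<close>
  have sm: "(\<Union>z\<in>H +>\<^bsub>M\<^esub> x. H +>\<^bsub>M\<^esub> (r \<odot>\<^bsub>M\<^esub> z)) = H +>\<^bsub>M\<^esub> (r \<odot>\<^bsub>M\<^esub> x)"
    if r: "r \<in> carrier R" and x: "x \<in> carrier M" for r x
  proof -
    have "H +>\<^bsub>M\<^esub> (r \<odot>\<^bsub>M\<^esub> z) = H +>\<^bsub>M\<^esub> (r \<odot>\<^bsub>M\<^esub> x)" if z: "z \<in> H +>\<^bsub>M\<^esub> x" for z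
    proof -
      obtain h where h: "h \<in> H" "z = h \<oplus>\<^bsub>M\<^esub> x"
        using z by (auto simp: a_r_coset_def')
      then have hc: "h \<in> carrier M"
        using a_subset by auto
      have "r \<odot>\<^bsub>M\<^esub> z \<ominus>\<^bsub>M\<^esub> r \<odot>\<^bsub>M\<^esub> x = r \<odot>\<^bsub>M\<^esub> h"
        using hc x r unfolding h(2)
        by (simp add: smult_r_distr a_minus_def M.a_assoc M.r_neg)
      then show ?thesis
        using coset_eq_iff[OF assms, of "r \<odot>\<^bsub>M\<^esub> z" "r \<odot>\<^bsub>M\<^esub> x"] h hc r x by auto
    qed
    moreover have "x \<in> H +>\<^bsub>M\<^esub> x"
      using a_rcos_self x by auto
    ultimately show ?thesis
      by blast
  qed
  show "(\<lambda>x. H +>\<^bsub>M\<^esub> x) \<in> module_hom R M (quotient_module M H)"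
    by (rule module_homI) (auto simp: quotient_module_def a_rcos_sum sm intro: M.a_rcosetsI a_subset)
qed

lemma fun_module_module:
  assumes "module R M"
  shows "module R (fun_module S M)"
proof -
  interpret module R M by fact
  have "abelian_group (fun_module S M)"
  proof (rule abelian_groupI)
    show "\<exists>y\<in>carrier (fun_module S M). y \<oplus>\<^bsub>fun_module S M\<^esub> x = \<zero>\<^bsub>fun_module S M\<^esub>"
      if "x \<in> carrier (fun_module S M)" for x
      using that by (intro bexI[of _ "\<lambda>s\<in>S. \<ominus>\<^bsub>M\<^esub> x s"])
        (auto simp: fun_module_def M.l_neg fun_eq_iff PiE_iff)
  qed (auto simp: fun_module_def M.a_ac fun_eq_iff PiE_iff extensional_def)
  then show ?thesis
    by (rule moduleI[OF R.is_cring])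
      (auto simp: fun_module_def fun_eq_iff PiE_iff smult_l_distr smult_r_distr smult_assoc1 extensional_def)
qed

text \<open>The triple (p1, p2, p3) is onto, and \<open>ker\<close> says that \<open>H\<close> is
  the preimage of B1 x B2 x 0; hence cosets of \<open>H\<close> and triples of cosets identify the
  same elements of \<open>M\<close>. The module structure of the targets, and the submodule property
  of B1 and B2, are inherited from \<open>M\<close> and \<open>H\<close> along the
  surjections.\<close>

lemma quotient_isomorphic_direct_sum:
  assumes M: "module R M" and H: "submodule H R M"
    and p: "p1 \<in> module_hom R M N1" "p2 \<in> module_hom R M N2" "p3 \<in> module_hom R M N3"
    and onto: "\<And>a b c. a \<in> carrier N1 \<Longrightarrow> b \<in> carrier N2 \<Longrightarrow> c \<in> carrier N3 \<Longrightarrow>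
      \<exists>x\<in>carrier M. p1 x = a \<and> p2 x = b \<and> p3 x = c"
    and zero: "p1 \<zero>\<^bsub>M\<^esub> = \<zero>\<^bsub>N1\<^esub>" "p2 \<zero>\<^bsub>M\<^esub> = \<zero>\<^bsub>N2\<^esub>" "p3 \<zero>\<^bsub>M\<^esub> = \<zero>\<^bsub>N3\<^esub>"
    and image: "p1 ` H = B1" "p2 ` H = B2"
    and ker: "\<And>x. x \<in> carrier M \<Longrightarrow> x \<in> H \<longleftrightarrow> p1 x \<in> B1 \<and> p2 x \<in> B2 \<and> p3 x = \<zero>\<^bsub>N3\<^esub>"
  shows "module_isomorphic R (quotient_module M H)
    (quotient_module N1 B1 \<oplus>\<^bold>m quotient_module N2 B2 \<oplus>\<^bold>m N3)"
proof -
  interpret M: module R M by fact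
  note h1 = module_homD[OF p(1)] and h2 = module_homD[OF p(2)] and h3 = module_homD[OF p(3)]
  have z: "\<zero>\<^bsub>N1\<^esub> \<in> carrier N1" "\<zero>\<^bsub>N2\<^esub> \<in> carrier N2" "\<zero>\<^bsub>N3\<^esub> \<in> carrier N3"
    using zero h1(1) h2(1) h3(1) M.M.zero_closed by metis+
  have N1: "module R N1"
    by (rule module_of_surjective_hom[OF M p(1) _ zero(1)]) (use onto z in blast)
  have N2: "module R N2"
    by (rule module_of_surjective_hom[OF M p(2) _ zero(2)]) (use onto z in blast)
  have N3: "module R N3"
    by (rule module_of_surjective_hom[OF M p(3) _ zero(3)]) (use onto z in blast)
  interpret N3: module R N3 by (fact N3)
  have B1: "submodule B1 R N1"
    using submodule_image[OF M N1 p(1) H] image by simp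
  have B2: "submodule B2 R N2"
    using submodule_image[OF M N2 p(2) H] image by simp
  note c1 = coset_map_hom[OF N1 B1] and c2 = coset_map_hom[OF N2 B2]
  note hc1 = module_homD[OF c1(1)] and hc2 = module_homD[OF c2(1)]
  let ?g = "\<lambda>x. (B1 +>\<^bsub>N1\<^esub> p1 x, B2 +>\<^bsub>N2\<^esub> p2 x, p3 x)"
  show ?thesis
  proof (rule module_isomorphic_of_same_fibres[OF M coset_map_hom(1,2)[OF M H]])
    show "?g \<in> module_hom R M (quotient_module N1 B1 \<oplus>\<^bold>m quotient_module N2 B2 \<oplus>\<^bold>m N3)"
      by (rule module_homI) (auto simp: direct_sum_module_def h1 h2 h3 hc1 hc2)
    show "carrier (quotient_module N1 B1 \<oplus>\<^bold>m quotient_module N2 B2 \<oplus>\<^bold>m N3) \<subseteq> ?g ` carrier M"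
    proof
      fix t assume "t \<in> carrier (quotient_module N1 B1 \<oplus>\<^bold>m quotient_module N2 B2 \<oplus>\<^bold>m N3)"
      then obtain a b c where t: "t = (B1 +>\<^bsub>N1\<^esub> a, B2 +>\<^bsub>N2\<^esub> b, c)"
        and "a \<in> carrier N1" "b \<in> carrier N2" "c \<in> carrier N3"
        using c1(2) c2(2) by (fastforce simp: direct_sum_module_def)
      then obtain x where "x \<in> carrier M" "p1 x = a" "p2 x = b" "p3 x = c"
        using onto by blast
      then show "t \<in> ?g ` carrier M"
        using t by blast
    qed
    fix x y assume xy: "x \<in> carrier M" "y \<in> carrier M"
    have "H +>\<^bsub>M\<^esub> x = H +>\<^bsub>M\<^esub> y \<longleftrightarrow> x \<ominus>\<^bsub>M\<^esub> y \<in> H"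
      by (rule coset_eq_iff[OF M H xy])
    also have "\<dots> \<longleftrightarrow> p1 x \<ominus>\<^bsub>N1\<^esub> p1 y \<in> B1 \<and> p2 x \<ominus>\<^bsub>N2\<^esub> p2 y \<in> B2 \<and> p3 x \<ominus>\<^bsub>N3\<^esub> p3 y = \<zero>\<^bsub>N3\<^esub>"
      using ker[of "x \<ominus>\<^bsub>M\<^esub> y"] xy module_hom_diff[OF p(1) M N1 xy]
        module_hom_diff[OF p(2) M N2 xy] module_hom_diff[OF p(3) M N3 xy] by simp
    also have "\<dots> \<longleftrightarrow> ?g x = ?g y"
      using coset_eq_iff[OF N1 B1] coset_eq_iff[OF N2 B2] h1(1) h2(1) h3(1) xy
      by (simp add: N3.M.diff_eq_zero_iff)
    finally show "H +>\<^bsub>M\<^esub> x = H +>\<^bsub>M\<^esub> y \<longleftrightarrow> ?g x = ?g y" .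
  qed
qed

section \<open>Poisson derivations and change of bracket\<close>

locale poisson_alg =
  fixes R :: "'r ring" and A :: "('r, 'a) module" and br :: "'a \<Rightarrow> 'a \<Rightarrow> 'a"
  assumes poisson: "poisson_algebra R A br"

sublocale poisson_alg \<subseteq> algebra R A
  using poisson by (simp add: poisson_algebra_def)

lemma derivations_self_iff:
  fixes R :: "'r ring"
  assumes "algebra R M"
  shows "X \<in> derivations R M (self_module M) \<longleftrightarrow> X \<in> module_hom R M M \<and>
    (\<forall>a\<in>carrier M. \<forall>b\<in>carrier M. X (a \<otimes>\<^bsub>M\<^esub> b) = a \<otimes>\<^bsub>M\<^esub> X b \<oplus>\<^bsub>M\<^esub> b \<otimes>\<^bsub>M\<^esub> X a)"
proof -
  interpret algebra R M by fact
  \<comment> \<open>On an algebra over itself, r acts through multiplication by r 1, which is the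
    original action, so restricting scalars does not change the R-linear maps.\<close>
  have s: "(r \<odot>\<^bsub>M\<^esub> \<one>\<^bsub>M\<^esub>) \<otimes>\<^bsub>M\<^esub> x = r \<odot>\<^bsub>M\<^esub> x" if "r \<in> carrier R" "x \<in> carrier M" for r x
    using that by (simp add: smult_assoc2)
  then have "X \<in> module_hom R M (restrict_scalars M (self_module M)) \<longleftrightarrow> X \<in> module_hom R M M"
    by (auto simp: module_hom_def restrict_scalars_def self_module_def s Pi_iff)
  then show ?thesis
    by (auto simp: derivations_def self_module_def)
qed

section \<open>Identities in a Poisson algebra and the modules \<open>Poiss\<close> and
  \<open>Ham\<close>\<close>

context poisson_alg
begin

lemmas derivations_iff = derivations_self_iff[OF algebra_axioms]

lemma bracket_hom_right: "f \<in> carrier A \<Longrightarrow> br f \<in> module_hom R A A"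
  and bracket_hom_left: "f \<in> carrier A \<Longrightarrow> (\<lambda>g. br g f) \<in> module_hom R A A"
  and bracket_self: "f \<in> carrier A \<Longrightarrow> br f f = \<zero>\<^bsub>A\<^esub>"
  and jacobi: "f \<in> carrier A \<Longrightarrow> g \<in> carrier A \<Longrightarrow> h \<in> carrier A \<Longrightarrow>
    br f (br g h) \<oplus>\<^bsub>A\<^esub> br g (br h f) \<oplus>\<^bsub>A\<^esub> br h (br f g) = \<zero>\<^bsub>A\<^esub>"
  and bracket_mult_right: "f \<in> carrier A \<Longrightarrow> g \<in> carrier A \<Longrightarrow> h \<in> carrier A \<Longrightarrow>
    br f (g \<otimes>\<^bsub>A\<^esub> h) = g \<otimes>\<^bsub>A\<^esub> br f h \<oplus>\<^bsub>A\<^esub> h \<otimes>\<^bsub>A\<^esub> br f g"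
  and bracket_mult_left: "f \<in> carrier A \<Longrightarrow> g \<in> carrier A \<Longrightarrow> h \<in> carrier A \<Longrightarrow>
    br (g \<otimes>\<^bsub>A\<^esub> h) f = g \<otimes>\<^bsub>A\<^esub> br h f \<oplus>\<^bsub>A\<^esub> h \<otimes>\<^bsub>A\<^esub> br g f"
  using poisson
  by (auto simp: poisson_algebra_def lie_bracket_def module_bilinear_def derivations_iff)

lemmas bracket_closed [simp, intro] = module_homD(1)[OF bracket_hom_right]
  and bracket_add_right = module_homD(2)[OF bracket_hom_right]
  and bracket_smult_right = module_homD(3)[OF bracket_hom_right]
  and bracket_add_left = module_homD(2)[OF bracket_hom_left]
  and bracket_smult_left = module_homD(3)[OF bracket_hom_left]
  and bracket_zero_right = module_hom_zero[OF bracket_hom_right module_axioms module_axioms]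
  and bracket_zero_left = module_hom_zero[OF bracket_hom_left module_axioms module_axioms]
  and bracket_minus_right = module_hom_minus[OF bracket_hom_right module_axioms module_axioms]
  and bracket_minus_left = module_hom_minus[OF bracket_hom_left module_axioms module_axioms]

text \<open>Polarisation: the alternating law at f + g leaves only the two mixed terms.\<close>

lemma bracket_skew:
  assumes "f \<in> carrier A" "g \<in> carrier A"
  shows "br f g = \<ominus>\<^bsub>A\<^esub> br g f"
proof -
  have "br (f \<oplus>\<^bsub>A\<^esub> g) (f \<oplus>\<^bsub>A\<^esub> g) = (br f f \<oplus>\<^bsub>A\<^esub> br f g) \<oplus>\<^bsub>A\<^esub> (br g f \<oplus>\<^bsub>A\<^esub> br g g)"
    using assms by (simp add: bracket_add_left bracket_add_right M.a_ac)
  then have "br f g \<oplus>\<^bsub>A\<^esub> br g f = \<zero>\<^bsub>A\<^esub>"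
    using assms bracket_self[of "f \<oplus>\<^bsub>A\<^esub> g"] by (simp add: bracket_self)
  then show ?thesis
    using assms by (metis M.minus_equality bracket_closed)
qed

text \<open>Jacobi in Leibniz form; this is what places the Hamiltonian derivations in
  \<open>Poiss\<close>.\<close>

lemma bracket_bracket:
  assumes "f \<in> carrier A" "g \<in> carrier A" "h \<in> carrier A"
  shows "br f (br g h) = br (br f g) h \<oplus>\<^bsub>A\<^esub> br g (br f h)"
proof -
  have "br f (br g h) \<ominus>\<^bsub>A\<^esub> (br (br f g) h \<oplus>\<^bsub>A\<^esub> br g (br f h)) =
    br f (br g h) \<oplus>\<^bsub>A\<^esub> br g (br h f) \<oplus>\<^bsub>A\<^esub> br h (br f g)"
    using assms bracket_skew[of "br f g" h] bracket_skew[of f h]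
    by (simp add: a_minus_def M.minus_add bracket_minus_right M.a_ac)
  then show ?thesis
    using assms jacobi[OF assms] M.diff_eq_zero_iff by simp
qed

lemma Poiss_iff:
  "X \<in> Poiss R A br \<longleftrightarrow> X \<in> carrier A \<rightarrow>\<^sub>E carrier A \<and> X \<in> module_hom R A A \<and>
    (\<forall>f\<in>carrier A. \<forall>g\<in>carrier A. X (f \<otimes>\<^bsub>A\<^esub> g) = f \<otimes>\<^bsub>A\<^esub> X g \<oplus>\<^bsub>A\<^esub> g \<otimes>\<^bsub>A\<^esub> X f) \<and>
    (\<forall>f\<in>carrier A. \<forall>g\<in>carrier A. X (br f g) = br (X f) g \<oplus>\<^bsub>A\<^esub> br f (X g))"
  by (auto simp: Poiss_def derivations_iff)

lemma PoissD:
  assumes "X \<in> Poiss R A br"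
  shows "X \<in> carrier A \<rightarrow>\<^sub>E carrier A" "X \<in> module_hom R A A"
    and "\<And>f g. f \<in> carrier A \<Longrightarrow> g \<in> carrier A \<Longrightarrow> X (f \<otimes>\<^bsub>A\<^esub> g) = f \<otimes>\<^bsub>A\<^esub> X g \<oplus>\<^bsub>A\<^esub> g \<otimes>\<^bsub>A\<^esub> X f"
    and "\<And>f g. f \<in> carrier A \<Longrightarrow> g \<in> carrier A \<Longrightarrow> X (br f g) = br (X f) g \<oplus>\<^bsub>A\<^esub> br f (X g)"
  using assms by (auto simp: Poiss_iff)

lemma fun_module_inv:
  assumes "X \<in> S \<rightarrow>\<^sub>E carrier A"
  shows "\<ominus>\<^bsub>fun_module S A\<^esub> X = (\<lambda>s\<in>S. \<ominus>\<^bsub>A\<^esub> X s)"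
proof -
  interpret F: module R "fun_module S A"
    by (rule fun_module_module[OF module_axioms])
  show ?thesis
    using assms by (intro F.M.minus_equality)
      (auto simp: fun_module_def fun_eq_iff M.l_neg PiE_iff)
qed

lemma Poiss_submodule: "submodule (Poiss R A br) R (fun_module (carrier A) A)"
proof -
  interpret F: module R "fun_module (carrier A) A"
    by (rule fun_module_module[OF module_axioms])
  show ?thesis
  proof (rule F.submoduleI)
    show "Poiss R A br \<subseteq> carrier (fun_module (carrier A) A)"
      by (auto simp: Poiss_def fun_module_def)
    show "\<zero>\<^bsub>fun_module (carrier A) A\<^esub> \<in> Poiss R A br"
      unfolding Poiss_iff
      by (auto simp: fun_module_def bracket_zero_left bracket_zero_right intro!: module_homI)
    show "\<ominus>\<^bsub>fun_module (carrier A) A\<^esub> X \<in> Poiss R A br" if X: "X \<in> Poiss R A br" for X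
    proof -
      note X1 = PoissD[OF X] note X2 = module_homD[OF X1(2)]
      show ?thesis
        unfolding fun_module_inv[OF X1(1)] Poiss_iff
        by (auto simp: X1(3,4) X2 M.minus_add smult_r_minus r_minus bracket_minus_left
            bracket_minus_right intro!: module_homI)
    qed
    show "X \<oplus>\<^bsub>fun_module (carrier A) A\<^esub> Y \<in> Poiss R A br"
      if X: "X \<in> Poiss R A br" and Y: "Y \<in> Poiss R A br" for X Y
    proof -
      note X1 = PoissD[OF X] note X2 = module_homD[OF X1(2)]
      note Y1 = PoissD[OF Y] note Y2 = module_homD[OF Y1(2)]
      show ?thesis
        unfolding Poiss_iff
        by (auto simp: fun_module_def X1(3,4) X2 Y1(3,4) Y2 smult_r_distr r_distr bracket_add_left
            bracket_add_right M.a_ac intro!: module_homI)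
    qed
    show "r \<odot>\<^bsub>fun_module (carrier A) A\<^esub> X \<in> Poiss R A br"
      if r: "r \<in> carrier R" and X: "X \<in> Poiss R A br" for r X
    proof -
      note X1 = PoissD[OF X] note X2 = module_homD[OF X1(2)]
      have s: "a \<otimes>\<^bsub>A\<^esub> (r \<odot>\<^bsub>A\<^esub> b) = r \<odot>\<^bsub>A\<^esub> (a \<otimes>\<^bsub>A\<^esub> b)" if "a \<in> carrier A" "b \<in> carrier A" for a b
        using that r by (metis m_comm smult_assoc2 smult_closed)
      show ?thesis
        unfolding Poiss_iff using r
        by (auto simp: fun_module_def X1(3,4) X2 smult_r_distr s bracket_smult_left
            bracket_smult_right smult_assoc1[symmetric] R.m_comm intro!: module_homI)
    qed
  qed
qed

abbreviation (input) "Poiss_module \<equiv> (fun_module (carrier A) A)\<lparr>carrier := Poiss R A br\<rparr>"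

lemma Poiss_module: "module R Poiss_module"
  by (rule submodule.submodule_is_module[OF Poiss_submodule fun_module_module[OF module_axioms]])

text \<open>Linearity in p exhibits \<open>Ham\<close> as the image of the whole algebra, from which
  it inherits the submodule property.\<close>

lemma hamiltonian_hom: "(\<lambda>p. \<lambda>x\<in>carrier A. br p x) \<in> module_hom R A Poiss_module"
proof (rule module_homI)
  fix p assume "p \<in> carrier A"
  then show "(\<lambda>x\<in>carrier A. br p x) \<in> carrier Poiss_module"
    by (auto simp: Poiss_iff bracket_add_right bracket_smult_right bracket_mult_right
        intro!: module_homI bracket_bracket)
qed (auto simp: fun_module_def bracket_add_left bracket_smult_left fun_eq_iff)

lemma Ham_eq_image: "Ham A br = (\<lambda>p. \<lambda>x\<in>carrier A. br p x) ` carrier A"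
  by (auto simp: Ham_def)

lemma Ham_submodule: "submodule (Ham A br) R Poiss_module"
  unfolding Ham_eq_image
  by (rule submodule_image[OF module_axioms Poiss_module hamiltonian_hom carrier_is_submodule])

end

section \<open>Transport of a Poisson bracket along an algebra automorphism\<close>

locale poisson_transport = poisson_alg R A br
  for R :: "'r ring" and A :: "('r, 'a) module" and br :: "'a \<Rightarrow> 'a \<Rightarrow> 'a" +
  fixes \<phi> \<psi> :: "'a \<Rightarrow> 'a" and br' :: "'a \<Rightarrow> 'a \<Rightarrow> 'a"
  assumes \<phi>_hom: "\<phi> \<in> module_hom R A A" and \<psi>_hom: "\<psi> \<in> module_hom R A A"
    and \<phi>_mult: "\<And>x y. x \<in> carrier A \<Longrightarrow> y \<in> carrier A \<Longrightarrow> \<phi> (x \<otimes>\<^bsub>A\<^esub> y) = \<phi> x \<otimes>\<^bsub>A\<^esub> \<phi> y"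
    and \<phi>_\<psi>: "\<And>x. x \<in> carrier A \<Longrightarrow> \<phi> (\<psi> x) = x"
    and \<psi>_\<phi>: "\<And>x. x \<in> carrier A \<Longrightarrow> \<psi> (\<phi> x) = x"
    and br': "\<And>x y. x \<in> carrier A \<Longrightarrow> y \<in> carrier A \<Longrightarrow> br' x y = \<phi> (br (\<psi> x) (\<psi> y))"
begin

lemmas phi = module_homD[OF \<phi>_hom] and psi = module_homD[OF \<psi>_hom]

lemma \<psi>_mult: "x \<in> carrier A \<Longrightarrow> y \<in> carrier A \<Longrightarrow> \<psi> (x \<otimes>\<^bsub>A\<^esub> y) = \<psi> x \<otimes>\<^bsub>A\<^esub> \<psi> y"
  by (metis m_closed \<phi>_\<psi> \<phi>_mult \<psi>_\<phi> psi(1))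

text \<open>Each axiom for \<open>br'\<close> is the \<phi>-image of the same axiom for
  \<open>br\<close> at \<psi>-arguments.\<close>

lemma transported: "poisson_algebra R A br'"
proof -
  have z: "\<phi> \<zero>\<^bsub>A\<^esub> = \<zero>\<^bsub>A\<^esub>"
    by (rule module_hom_zero[OF \<phi>_hom module_axioms module_axioms])
  have j: "br' f (br' g h) \<oplus>\<^bsub>A\<^esub> br' g (br' h f) \<oplus>\<^bsub>A\<^esub> br' h (br' f g) = \<zero>\<^bsub>A\<^esub>"
    if "f \<in> carrier A" "g \<in> carrier A" "h \<in> carrier A" for f g h
    using that jacobi[of "\<psi> f" "\<psi> g" "\<psi> h"] by (simp add: br' \<psi>_\<phi> phi(1) psi(1) z phi(2)[symmetric])
  show ?thesis
    using algebra_axioms j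
    by (auto simp: poisson_algebra_def lie_bracket_def module_bilinear_def derivations_iff
        br' bracket_add_left bracket_add_right bracket_smult_left bracket_smult_right
        bracket_mult_left bracket_mult_right bracket_self phi psi \<phi>_mult \<psi>_mult z \<phi>_\<psi>
        intro!: module_homI)
qed

sublocale B: poisson_alg R A br'
  using transported by unfold_locales

lemma conjugation_hom:
  "(\<lambda>X. \<lambda>x\<in>carrier A. \<phi> (X (\<psi> x))) \<in> module_hom R Poiss_module B.Poiss_module"
proof (rule module_homI)
  fix X assume "X \<in> carrier Poiss_module"
  then have "X \<in> Poiss R A br"
    by simp
  note X1 = PoissD[OF this] note X2 = module_homD[OF X1(2)]
  show "(\<lambda>x\<in>carrier A. \<phi> (X (\<psi> x))) \<in> carrier B.Poiss_module"
    by (auto simp: B.Poiss_iff X1(3,4) X2 phi psi \<phi>_mult \<psi>_mult br' \<phi>_\<psi> \<psi>_\<phi> intro!: module_homI)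
next
  fix X Y assume "X \<in> carrier Poiss_module" "Y \<in> carrier Poiss_module"
  then have "X \<in> carrier A \<rightarrow>\<^sub>E carrier A" "Y \<in> carrier A \<rightarrow>\<^sub>E carrier A"
    by (auto simp: Poiss_def)
  then show "(\<lambda>x\<in>carrier A. \<phi> ((X \<oplus>\<^bsub>Poiss_module\<^esub> Y) (\<psi> x))) =
    (\<lambda>x\<in>carrier A. \<phi> (X (\<psi> x))) \<oplus>\<^bsub>B.Poiss_module\<^esub> (\<lambda>x\<in>carrier A. \<phi> (Y (\<psi> x)))"
    by (auto simp: fun_module_def fun_eq_iff psi PiE_iff phi)
next
  fix r X assume "r \<in> carrier R" "X \<in> carrier Poiss_module"
  then have "r \<in> carrier R" "X \<in> carrier A \<rightarrow>\<^sub>E carrier A"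
    by (auto simp: Poiss_def)
  then show "(\<lambda>x\<in>carrier A. \<phi> ((r \<odot>\<^bsub>Poiss_module\<^esub> X) (\<psi> x))) =
    r \<odot>\<^bsub>B.Poiss_module\<^esub> (\<lambda>x\<in>carrier A. \<phi> (X (\<psi> x)))"
    by (auto simp: fun_module_def fun_eq_iff psi PiE_iff phi)
qed

text \<open>The situation is symmetric in (\<phi>, \<open>br\<close>) and (\<psi>,
  \<open>br'\<close>); for this symmetry \<open>br'\<close> is a parameter with an equation on the
  carrier. The inverse of conjugation by \<phi> is then an instance of the same
  construction.\<close>

lemma inverse_transport: "poisson_transport R A br' \<psi> \<phi> br"
proof
qed (auto simp: \<phi>_hom \<psi>_hom \<psi>_mult \<phi>_\<psi> \<psi>_\<phi> br' phi(1))

interpretation inv: poisson_transport R A br' \<psi> \<phi> br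
  by (rule inverse_transport)

abbreviation (input) "conjugate X \<equiv> \<lambda>x\<in>carrier A. \<phi> (X (\<psi> x))"

lemma conj_inverse:
  assumes "Y \<in> Poiss R A br'"
  shows "conjugate (\<lambda>x\<in>carrier A. \<psi> (Y (\<phi> x))) = Y"
proof
  fix x
  show "conjugate (\<lambda>x\<in>carrier A. \<psi> (Y (\<phi> x))) x = Y x"
    using B.PoissD(1)[OF assms] by (auto simp: psi(1) \<phi>_\<psi> PiE_iff extensional_def)
qed

text \<open>Conjugation turns {p, .} into the transported {\<phi> p, .}, since \<psi> \<phi> is the
  identity. Conversely, if the conjugate is generated by p, evaluating it at \<phi> x shows that X
  is generated by \<psi> p.\<close>

lemma conj_in_Ham_iff:
  assumes X: "X \<in> Poiss R A br"
  shows "conjugate X \<in> Ham A br' \<longleftrightarrow> X \<in> Ham A br"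
proof -
  note X1 = PoissD[OF X]
  have "conjugate X \<in> Ham A br'" if H: "X \<in> Ham A br"
  proof -
    obtain p where p: "p \<in> carrier A" "X = (\<lambda>x\<in>carrier A. br p x)"
      using H by (auto simp: Ham_def)
    then have "conjugate X = (\<lambda>x\<in>carrier A. br' (\<phi> p) x)"
      by (auto simp: fun_eq_iff br' phi(1) psi(1) \<psi>_\<phi>)
    then show ?thesis
      using p phi(1) by (auto simp: Ham_def)
  qed
  moreover have "X \<in> Ham A br" if Y: "conjugate X \<in> Ham A br'"
  proof -
    obtain p where p: "p \<in> carrier A" "conjugate X = (\<lambda>x\<in>carrier A. br' p x)"
      using Y by (auto simp: Ham_def)
    have "X x = br (\<psi> p) x" if x: "x \<in> carrier A" for x
    proof -
      have "\<psi> (conjugate X (\<phi> x)) = \<psi> (br' p (\<phi> x))"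
        using x p(2) by (simp add: phi(1))
      then show ?thesis
        using x p(1) PiE_mem[OF X1(1) x] by (simp add: phi(1) psi(1) \<psi>_\<phi> br')
    qed
    moreover have "X \<in> extensional (carrier A)"
      using X1(1) by (simp add: PiE_iff)
    ultimately have "X = (\<lambda>x\<in>carrier A. br (\<psi> p) x)"
      by (auto simp: fun_eq_iff extensional_def)
    then show ?thesis
      using p(1) psi(1) by (auto simp: Ham_def)
  qed
  ultimately show ?thesis
    by blast
qed

lemma poisson_H1_isomorphic: "module_isomorphic R (poisson_H1 R A br) (poisson_H1 R A br')"
proof -
  note c = coset_map_hom[OF Poiss_module Ham_submodule]
  note c' = coset_map_hom[OF B.Poiss_module B.Ham_submodule]
  note hom = conjugation_hom
  \<comment> \<open>Conjugation by \<psi> supplies preimages, so this map is onto; by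
    \<open>conj_in_Ham_iff\<close> it identifies the same derivations as the coset map of
    \<open>Ham A br\<close>.\<close>
  let ?g = "\<lambda>X. Ham A br' +>\<^bsub>B.Poiss_module\<^esub> conjugate X"
  interpret M: module R Poiss_module
    by (rule Poiss_module)
  show ?thesis
    unfolding poisson_H1_def
  proof (rule module_isomorphic_of_same_fibres[OF Poiss_module c(1,2)])
    show "?g \<in> module_hom R Poiss_module (quotient_module B.Poiss_module (Ham A br'))"
      using module_homD[OF hom] module_homD[OF c'(1)] by (intro module_homI) presburger+
    show "carrier (quotient_module B.Poiss_module (Ham A br')) \<subseteq> ?g ` carrier Poiss_module"
    proof
      fix t assume "t \<in> carrier (quotient_module B.Poiss_module (Ham A br'))"
      then obtain Y where Y: "Y \<in> Poiss R A br'" "t = Ham A br' +>\<^bsub>B.Poiss_module\<^esub> Y"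
        using c'(2) by auto
      have "(\<lambda>x\<in>carrier A. \<psi> (Y (\<phi> x))) \<in> carrier Poiss_module"
        using module_homD(1)[OF inv.conjugation_hom] Y(1) by simp
      then show "t \<in> ?g ` carrier Poiss_module"
        using conj_inverse[OF Y(1)] Y(2) by (intro image_eqI) auto
    qed
    fix X Y assume XY: "X \<in> carrier Poiss_module" "Y \<in> carrier Poiss_module"
    have "Ham A br +>\<^bsub>Poiss_module\<^esub> X = Ham A br +>\<^bsub>Poiss_module\<^esub> Y \<longleftrightarrow>
      X \<ominus>\<^bsub>Poiss_module\<^esub> Y \<in> Ham A br"
      by (rule coset_eq_iff[OF Poiss_module Ham_submodule XY])
    also have "\<dots> \<longleftrightarrow> conjugate (X \<ominus>\<^bsub>Poiss_module\<^esub> Y) \<in> Ham A br'"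
      using conj_in_Ham_iff M.M.minus_closed[OF XY] by simp
    also have "\<dots> \<longleftrightarrow> conjugate X \<ominus>\<^bsub>B.Poiss_module\<^esub> conjugate Y \<in> Ham A br'"
      using module_hom_diff[OF hom Poiss_module B.Poiss_module XY] by simp
    also have "\<dots> \<longleftrightarrow> ?g X = ?g Y"
      using coset_eq_iff[OF B.Poiss_module B.Ham_submodule] module_homD(1)[OF hom] XY by blast
    finally show "Ham A br +>\<^bsub>Poiss_module\<^esub> X = Ham A br +>\<^bsub>Poiss_module\<^esub> Y \<longleftrightarrow> ?g X = ?g Y" .
  qed
qed

end

lemma module_isomorphic_trans [trans]:
  assumes "module_isomorphic R L M" "module_isomorphic R M N"
  shows "module_isomorphic R L N"
proof -
  obtain h k where h: "h \<in> module_hom R L M" "bij_betw h (carrier L) (carrier M)"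
    and k: "k \<in> module_hom R M N" "bij_betw k (carrier M) (carrier N)"
    using assms by (auto simp: module_isomorphic_def)
  have "k \<circ> h \<in> module_hom R L N"
    using module_homD[OF h(1)] module_homD[OF k(1)] by (auto intro!: module_homI)
  then show ?thesis
    using bij_betw_trans[OF h(2) k(2)] by (auto simp: module_isomorphic_def)
qed

section \<open>Split admissible Poisson algebras\<close>

lemma restrict_scalars_simps [simp]:
  "carrier (restrict_scalars A M) = carrier M"
  "add (restrict_scalars A M) = add M"
  "zero (restrict_scalars A M) = zero M"
  "r \<odot>\<^bsub>restrict_scalars A M\<^esub> x = (r \<odot>\<^bsub>A\<^esub> \<one>\<^bsub>A\<^esub>) \<odot>\<^bsub>M\<^esub> x"
  by (simp_all add: restrict_scalars_def)

lemma semidirect_simps [simp]: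
  "carrier (A \<ltimes> M) = carrier A \<times> carrier M"
  "zero (A \<ltimes> M) = (\<zero>\<^bsub>A\<^esub>, \<zero>\<^bsub>M\<^esub>)"
  "(f, \<eta>) \<oplus>\<^bsub>A \<ltimes> M\<^esub> (g, \<xi>) = (f \<oplus>\<^bsub>A\<^esub> g, \<eta> \<oplus>\<^bsub>M\<^esub> \<xi>)"
  "(f, \<eta>) \<otimes>\<^bsub>A \<ltimes> M\<^esub> (g, \<xi>) = (f \<otimes>\<^bsub>A\<^esub> g, f \<odot>\<^bsub>M\<^esub> \<xi> \<oplus>\<^bsub>M\<^esub> g \<odot>\<^bsub>M\<^esub> \<eta>)"
  "r \<odot>\<^bsub>A \<ltimes> M\<^esub> (f, \<eta>) = (r \<odot>\<^bsub>A\<^esub> f, (r \<odot>\<^bsub>A\<^esub> \<one>\<^bsub>A\<^esub>) \<odot>\<^bsub>M\<^esub> \<eta>)"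
  by (simp_all add: semidirect_def)

lemma semidirect_proj [simp]:
  "fst (x \<oplus>\<^bsub>A \<ltimes> M\<^esub> y) = fst x \<oplus>\<^bsub>A\<^esub> fst y" "snd (x \<oplus>\<^bsub>A \<ltimes> M\<^esub> y) = snd x \<oplus>\<^bsub>M\<^esub> snd y"
  "fst (r \<odot>\<^bsub>A \<ltimes> M\<^esub> x) = r \<odot>\<^bsub>A\<^esub> fst x"
  "snd (r \<odot>\<^bsub>A \<ltimes> M\<^esub> x) = (r \<odot>\<^bsub>A\<^esub> \<one>\<^bsub>A\<^esub>) \<odot>\<^bsub>M\<^esub> snd x"
  by (simp_all add: semidirect_def case_prod_beta)

section \<open>Cochains and differentials in low degree, restriction of scalars\<close>

lemma tuples_simps:
  "tuples A 0 = {[]}" "tuples A 1 = (\<lambda>f. [f]) ` carrier A"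
  "tuples A 2 = (\<lambda>(f, g). [f, g]) ` (carrier A \<times> carrier A)"
proof -
  show "tuples A 1 = (\<lambda>f. [f]) ` carrier A"
    by (force simp: tuples_def length_Suc_conv)
  show "tuples A 2 = (\<lambda>(f, g). [f, g]) ` (carrier A \<times> carrier A)"
    by (force simp: tuples_def length_Suc_conv numeral_2_eq_2)
qed (auto simp: tuples_def)

lemma differential_0:
  assumes M: "abelian_group M" and f: "f \<in> carrier A"
    and D: "D (kaehler_d R A f) (Q []) \<in> carrier M"
  shows "differential R A br M D 0 Q [f] = D (kaehler_d R A f) (Q [])"
proof -
  interpret abelian_group M by fact
  have e: "{(i, j). i < j \<and> j = (0::nat)} = {}"
    by auto
  show ?thesis
    using f D by (simp add: e differential_def tuples_simps(2)[simplified] omit_nth_def finsum_insert)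
qed

lemma differential_1:
  assumes M: "abelian_group M" and fg: "f \<in> carrier A" "g \<in> carrier A"
    and D: "D (kaehler_d R A f) (Q [g]) \<in> carrier M" "D (kaehler_d R A g) (Q [f]) \<in> carrier M"
      "Q [br f g] \<in> carrier M"
  shows "differential R A br M D 1 Q [f, g] =
    D (kaehler_d R A f) (Q [g]) \<ominus>\<^bsub>M\<^esub> D (kaehler_d R A g) (Q [f]) \<ominus>\<^bsub>M\<^esub> Q [br f g]"
proof -
  interpret abelian_group M by fact
  \<comment> \<open>In degree one the second sum of the differential has a single term, with sign
    (-1)^(0+1).\<close>
  have e: "{(i, j). i < j \<and> j \<le> Suc 0} = {(0, Suc 0)}"
    by auto
  have m: "[(- 1 :: int)] \<cdot>\<^bsub>M\<^esub> x = \<ominus>\<^bsub>M\<^esub> x" if "x \<in> carrier M" for x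
    using that by (simp add: add_pow_int_lt)
  have t: "[f, g] \<in> tuples A (Suc (Suc 0))"
    using fg by (simp add: tuples_def)
  have "{..Suc 0} = {0, Suc 0}"
    by auto
  then show ?thesis
    using t D by (simp add: differential_def omit_nth_def e finsum_insert m a_minus_def)
qed

lemma restrict_scalars_module:
  assumes "algebra R A" "module A M"
  shows "module R (restrict_scalars A M)"
proof -
  interpret A: algebra R A by fact
  interpret V: module A M by fact
  have "abelian_group (restrict_scalars A M)"
    by (rule abelian_groupI) (auto simp: V.M.a_ac intro: V.M.add.l_inv_ex)
  then show ?thesis
    by (rule moduleI[OF A.R_cring])
      (auto simp: A.smult_l_distr V.smult_l_distr V.smult_r_distr V.smult_assoc1[symmetric]
        A.smult_assoc2 A.smult_assoc1)
qed

text \<open>Additive inverses depend only on carrier, addition and zero, all of which survive the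
  change of scalars.\<close>

lemma restrict_scalars_inv: "\<ominus>\<^bsub>restrict_scalars A M\<^esub> x = \<ominus>\<^bsub>M\<^esub> x"
  by (simp add: a_inv_def m_inv_def)

text \<open>With a single slot there are no two distinct indices, so skewness is vacuous.\<close>

lemma multiderivations_1_iff:
  "Q \<in> carrier (multiderivations R A M 1) \<longleftrightarrow>
    Q \<in> tuples A 1 \<rightarrow>\<^sub>E carrier M \<and> (\<lambda>f. Q [f]) \<in> derivations R A M"
  by (auto simp: multiderivations_def tuples_simps(2)[simplified])
    (simp add: derivations_def module_hom_def)

text \<open>The case K = 0. The derivative enters the bracket only through exact differentials, so
  the assumptions concern the operators D_df. Their rules in f are recovered from the Poisson
  identities on \<open>P0 \<ltimes> P1\<close>.\<close>

locale split_poisson = P: poisson_alg R "P0 \<ltimes> P1" br + A: poisson_alg R P0 br0 + V: module P0 P1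
  for R :: "'r ring" and P0 :: "('r, 'a) module" and P1 :: "('a, 'b) module"
    and br0 :: "'a \<Rightarrow> 'a \<Rightarrow> 'a" and br :: "'a \<times> 'b \<Rightarrow> 'a \<times> 'b \<Rightarrow> 'a \<times> 'b" +
  fixes D :: "('a \<Rightarrow> 'a) set \<Rightarrow> 'b \<Rightarrow> 'b"
  assumes faithful: "\<And>f. f \<in> carrier P0 \<Longrightarrow> (\<And>\<eta>. \<eta> \<in> carrier P1 \<Longrightarrow> f \<odot>\<^bsub>P1\<^esub> \<eta> = \<zero>\<^bsub>P1\<^esub>) \<Longrightarrow>
      f = \<zero>\<^bsub>P0\<^esub>"
    and nabla_hom: "\<And>f. f \<in> carrier P0 \<Longrightarrow> D (kaehler_d R P0 f) \<in>
      module_hom R (restrict_scalars P0 P1) (restrict_scalars P0 P1)"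
    and bracket: "\<And>f g \<eta> \<xi>. f \<in> carrier P0 \<Longrightarrow> \<eta> \<in> carrier P1 \<Longrightarrow> g \<in> carrier P0 \<Longrightarrow> \<xi> \<in> carrier P1 \<Longrightarrow>
      br (f, \<eta>) (g, \<xi>) = (br0 f g, D (kaehler_d R P0 f) \<xi> \<ominus>\<^bsub>P1\<^esub> D (kaehler_d R P0 g) \<eta>)"
begin

definition nabla :: "'a \<Rightarrow> 'b \<Rightarrow> 'b" where
  "nabla f = D (kaehler_d R P0 f)"

lemmas bracket_nabla = bracket[folded nabla_def]

lemmas restricted_module = restrict_scalars_module[OF A.algebra_axioms V.module_axioms]

lemmas nabla_homs = module_homD[OF nabla_hom[folded nabla_def], simplified]

lemmas nabla_closed [simp, intro] = nabla_homs(1)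
  and nabla_add_right = nabla_homs(2)
  and nabla_zero_right [simp] =
    module_hom_zero[OF nabla_hom[folded nabla_def] restricted_module restricted_module, simplified]
  and nabla_minus_right =
    module_hom_minus[OF nabla_hom[folded nabla_def] restricted_module restricted_module,
      simplified, unfolded restrict_scalars_inv]

lemma nabla_zero_left [simp]: "\<eta> \<in> carrier P1 \<Longrightarrow> nabla \<zero>\<^bsub>P0\<^esub> \<eta> = \<zero>\<^bsub>P1\<^esub>"
  using P.bracket_zero_left[of "(\<zero>\<^bsub>P0\<^esub>, \<eta>)"] by (simp add: bracket_nabla a_minus_def V.M.minus_zero_eq)

lemma nabla_add_left:
  "f \<in> carrier P0 \<Longrightarrow> g \<in> carrier P0 \<Longrightarrow> \<eta> \<in> carrier P1 \<Longrightarrow>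
    nabla (f \<oplus>\<^bsub>P0\<^esub> g) \<eta> = nabla f \<eta> \<oplus>\<^bsub>P1\<^esub> nabla g \<eta>"
  using P.bracket_add_left[of "(\<zero>\<^bsub>P0\<^esub>, \<eta>)" "(f, \<zero>\<^bsub>P1\<^esub>)" "(g, \<zero>\<^bsub>P1\<^esub>)"]
  by (simp add: bracket_nabla a_minus_def V.M.minus_zero_eq)

text \<open>Since {(f, 0), (0, \<eta>)} = (0, D_df \<eta>) and (g, 0)(0, \<eta>) = (0, g \<eta>),
  this is the Leibniz rule of the bracket for that product.\<close>

lemma nabla_leibniz:
  "f \<in> carrier P0 \<Longrightarrow> g \<in> carrier P0 \<Longrightarrow> \<eta> \<in> carrier P1 \<Longrightarrow>
    nabla f (g \<odot>\<^bsub>P1\<^esub> \<eta>) = g \<odot>\<^bsub>P1\<^esub> nabla f \<eta> \<oplus>\<^bsub>P1\<^esub> br0 f g \<odot>\<^bsub>P1\<^esub> \<eta>"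
  using P.bracket_mult_right[of "(f, \<zero>\<^bsub>P1\<^esub>)" "(g, \<zero>\<^bsub>P1\<^esub>)" "(\<zero>\<^bsub>P0\<^esub>, \<eta>)"]
  by (simp add: bracket_nabla a_minus_def V.M.minus_zero_eq A.bracket_zero_right)

text \<open>A 1-cochain is taken as a function on \<open>P0\<close> instead of on lists of length
  one; the second condition is d_D q = 0 solved for q {f, g}_0.\<close>

definition cocycle1 :: "('a \<Rightarrow> 'b) \<Rightarrow> bool" where
  "cocycle1 q \<longleftrightarrow> q \<in> derivations R P0 P1 \<and>
    (\<forall>f\<in>carrier P0. \<forall>g\<in>carrier P0. q (br0 f g) = nabla f (q g) \<ominus>\<^bsub>P1\<^esub> nabla g (q f))"

lemma derivations_cong:
  assumes "\<And>f. f \<in> carrier P0 \<Longrightarrow> q f = q' f" 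
  shows "q \<in> derivations R P0 P1 \<longleftrightarrow> q' \<in> derivations R P0 P1"
  using assms by (simp add: derivations_def module_hom_def Pi_iff)

lemma cocycles_1_iff:
  "Q \<in> carrier (cocycles R P0 br0 P1 D 1) \<longleftrightarrow>
    Q \<in> tuples P0 1 \<rightarrow>\<^sub>E carrier P1 \<and> cocycle1 (\<lambda>f. Q [f])"
proof (cases "Q \<in> carrier (multiderivations R P0 P1 1)")
  case True
  then have Q: "Q [f] \<in> carrier P1" if "f \<in> carrier P0" for f
    using that by (auto simp: multiderivations_1_iff tuples_simps(2) PiE_iff simp del: One_nat_def)
  have d: "differential R P0 br0 P1 D 1 Q [f, g] = nabla f (Q [g]) \<ominus>\<^bsub>P1\<^esub> nabla g (Q [f]) \<ominus>\<^bsub>P1\<^esub> Q [br0 f g]"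
    if "f \<in> carrier P0" "g \<in> carrier P0" for f g
    unfolding nabla_def
    by (rule differential_1) (use that Q in \<open>auto simp flip: nabla_def intro: V.M.abelian_group_axioms\<close>)
  have "differential R P0 br0 P1 D 1 Q = \<zero>\<^bsub>multiderivations R P0 P1 (Suc 1)\<^esub> \<longleftrightarrow>
    (\<forall>fs\<in>tuples P0 2. differential R P0 br0 P1 D 1 Q fs = \<zero>\<^bsub>P1\<^esub>)"
    by (auto simp: multiderivations_def fun_module_def differential_def fun_eq_iff numeral_2_eq_2)
  also have "\<dots> \<longleftrightarrow> (\<forall>f\<in>carrier P0. \<forall>g\<in>carrier P0.
      Q [br0 f g] = nabla f (Q [g]) \<ominus>\<^bsub>P1\<^esub> nabla g (Q [f]))"
    unfolding tuples_simps using d Q by (auto simp: V.M.diff_eq_zero_iff)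
  finally show ?thesis
    using True by (auto simp: cocycles_def cocycle1_def multiderivations_1_iff simp del: One_nat_def)
next
  case False
  then show ?thesis
    by (auto simp: cocycles_def cocycle1_def multiderivations_1_iff simp del: One_nat_def)
qed

lemma coboundaries_1:
  "coboundaries R P0 br0 P1 D 1 = (\<lambda>\<eta>. \<lambda>fs\<in>tuples P0 1. nabla (fs ! 0) \<eta>) ` carrier P1"
proof -
  have d: "differential R P0 br0 P1 D 0 Q = (\<lambda>fs\<in>tuples P0 1. nabla (fs ! 0) (Q []))"
    if Q: "Q [] \<in> carrier P1" for Q
  proof
    fix fs
    have "differential R P0 br0 P1 D 0 Q [f] = nabla f (Q [])" if "f \<in> carrier P0" for f
      unfolding nabla_def
      by (rule differential_0) (use that Q in \<open>auto simp flip: nabla_def intro: V.M.abelian_group_axioms\<close>)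
    then show "differential R P0 br0 P1 D 0 Q fs = (\<lambda>fs\<in>tuples P0 1. nabla (fs ! 0) (Q [])) fs"
      by (cases "fs \<in> tuples P0 1") (auto simp: tuples_simps(2)[simplified], simp add: differential_def tuples_simps(2)[simplified])
  qed
  have c: "carrier (multiderivations R P0 P1 0) = {[]} \<rightarrow>\<^sub>E carrier P1"
    by (auto simp: multiderivations_def tuples_simps)
  have "coboundaries R P0 br0 P1 D 1 = differential R P0 br0 P1 D 0 ` ({[] :: 'a list} \<rightarrow>\<^sub>E carrier P1)"
    unfolding One_nat_def coboundaries.simps c ..
  also have "\<dots> = (\<lambda>Q. \<lambda>fs\<in>tuples P0 1. nabla (fs ! 0) (Q [])) ` ({[] :: 'a list} \<rightarrow>\<^sub>E carrier P1)"
    by (rule image_cong) (auto simp: d PiE_iff)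
  also have "\<dots> = (\<lambda>\<eta>. \<lambda>fs\<in>tuples P0 1. nabla (fs ! 0) \<eta>) ` ((\<lambda>Q. Q []) ` ({[] :: 'a list} \<rightarrow>\<^sub>E carrier P1))"
    by (simp add: image_image)
  also have "(\<lambda>Q. Q []) ` ({[] :: 'a list} \<rightarrow>\<^sub>E carrier P1) = carrier P1"
  proof
    show "carrier P1 \<subseteq> (\<lambda>Q. Q []) ` ({[] :: 'a list} \<rightarrow>\<^sub>E carrier P1)"
      \<comment> \<open>The witness is the 0-cochain with value x at the empty list, its only
        argument.\<close>
      by (rule subsetI, rule_tac x = "\<lambda>fs\<in>{[]}. x" in image_eqI) auto
  qed (auto simp: PiE_iff)
  finally show ?thesis .
qed

text \<open>The defining conditions of \<open>M_tilde\<close> and \<open>E_module\<close>, without extensionality.\<close>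

definition lifts :: "('b \<Rightarrow> 'b) \<Rightarrow> ('a \<Rightarrow> 'a) \<Rightarrow> bool" where
  "lifts L l \<longleftrightarrow> L \<in> module_hom R (restrict_scalars P0 P1) (restrict_scalars P0 P1) \<and>
    (\<forall>f\<in>carrier P0. \<forall>\<eta>\<in>carrier P1. L (f \<odot>\<^bsub>P1\<^esub> \<eta>) = f \<odot>\<^bsub>P1\<^esub> L \<eta> \<oplus>\<^bsub>P1\<^esub> l f \<odot>\<^bsub>P1\<^esub> \<eta> \<and>
      L (nabla f \<eta>) = nabla f (L \<eta>) \<oplus>\<^bsub>P1\<^esub> nabla (l f) \<eta>)"

definition skew_equivariant :: "('b \<Rightarrow> 'a) \<Rightarrow> bool" where
  "skew_equivariant T \<longleftrightarrow> T \<in> module_hom P0 P1 (self_module P0) \<and>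
    (\<forall>\<eta>\<in>carrier P1. \<forall>\<xi>\<in>carrier P1. T \<xi> \<odot>\<^bsub>P1\<^esub> \<eta> \<oplus>\<^bsub>P1\<^esub> T \<eta> \<odot>\<^bsub>P1\<^esub> \<xi> = \<zero>\<^bsub>P1\<^esub>) \<and>
    (\<forall>f\<in>carrier P0. \<forall>\<eta>\<in>carrier P1. T (nabla f \<eta>) = br0 f (T \<eta>)) \<and>
    (\<forall>\<eta>\<in>carrier P1. \<forall>\<xi>\<in>carrier P1. nabla (T \<eta>) \<xi> = nabla (T \<xi>) \<eta>)"

lemma E_module_iff:
  "T \<in> carrier (E_module R P0 br0 P1 D) \<longleftrightarrow> T \<in> carrier P1 \<rightarrow>\<^sub>E carrier P0 \<and> skew_equivariant T"
  by (auto simp: E_module_def skew_equivariant_def nabla_def)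

text \<open>The commutator condition is solved for \<open>L (nabla f \<eta>)\<close>, because
  compatibility of X with the bracket of (f, 0) and (0, \<eta>) produces it in that form.\<close>

lemma M_tilde_iff:
  "L \<in> carrier (M_tilde R P0 br0 P1 D) \<longleftrightarrow>
    L \<in> carrier P1 \<rightarrow>\<^sub>E carrier P1 \<and> (\<exists>l\<in>Poiss R P0 br0. lifts L l)"
proof -
  have e: "nabla f (L \<eta>) \<ominus>\<^bsub>P1\<^esub> L (nabla f \<eta>) = \<ominus>\<^bsub>P1\<^esub> nabla (l f) \<eta> \<longleftrightarrow>
      L (nabla f \<eta>) = nabla f (L \<eta>) \<oplus>\<^bsub>P1\<^esub> nabla (l f) \<eta>"
    if "f \<in> carrier P0" "\<eta> \<in> carrier P1" "l \<in> Poiss R P0 br0" "L \<in> carrier P1 \<rightarrow>\<^sub>E carrier P1" for f \<eta> l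
  proof -
    define a b c where "a = L (nabla f \<eta>)" and "b = nabla f (L \<eta>)" and "c = nabla (l f) \<eta>"
    have "l f \<in> carrier P0"
      using A.PoissD(1)[OF that(3)] that(1) by auto
    then have c: "a \<in> carrier P1" "b \<in> carrier P1" "c \<in> carrier P1"
      using that(1,2,4) by (auto simp: a_def b_def c_def)
    have "b \<ominus>\<^bsub>P1\<^esub> a = \<ominus>\<^bsub>P1\<^esub> c \<longleftrightarrow> b \<ominus>\<^bsub>P1\<^esub> a \<ominus>\<^bsub>P1\<^esub> (\<ominus>\<^bsub>P1\<^esub> c) = \<zero>\<^bsub>P1\<^esub>"
      using c V.M.diff_eq_zero_iff by simp
    also have "b \<ominus>\<^bsub>P1\<^esub> a \<ominus>\<^bsub>P1\<^esub> (\<ominus>\<^bsub>P1\<^esub> c) = (b \<oplus>\<^bsub>P1\<^esub> c) \<ominus>\<^bsub>P1\<^esub> a"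
      using c by (simp add: a_minus_def V.M.a_ac)
    also have "\<dots> = \<zero>\<^bsub>P1\<^esub> \<longleftrightarrow> a = b \<oplus>\<^bsub>P1\<^esub> c"
      using c V.M.diff_eq_zero_iff by auto
    finally show ?thesis
      unfolding a_def b_def c_def .
  qed
  have "(\<forall>f\<in>carrier P0. \<forall>\<eta>\<in>carrier P1. L (f \<odot>\<^bsub>P1\<^esub> \<eta>) = f \<odot>\<^bsub>P1\<^esub> L \<eta> \<oplus>\<^bsub>P1\<^esub> l f \<odot>\<^bsub>P1\<^esub> \<eta> \<and>
      nabla f (L \<eta>) \<ominus>\<^bsub>P1\<^esub> L (nabla f \<eta>) = \<ominus>\<^bsub>P1\<^esub> nabla (l f) \<eta>) \<longleftrightarrow>
    (\<forall>f\<in>carrier P0. \<forall>\<eta>\<in>carrier P1. L (f \<odot>\<^bsub>P1\<^esub> \<eta>) = f \<odot>\<^bsub>P1\<^esub> L \<eta> \<oplus>\<^bsub>P1\<^esub> l f \<odot>\<^bsub>P1\<^esub> \<eta> \<and>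
      L (nabla f \<eta>) = nabla f (L \<eta>) \<oplus>\<^bsub>P1\<^esub> nabla (l f) \<eta>)"
    if "l \<in> Poiss R P0 br0" "L \<in> carrier P1 \<rightarrow>\<^sub>E carrier P1" for l
    by (intro ball_cong conj_cong refl e that)
  then show ?thesis
    by (simp add: M_tilde_def lifts_def nabla_def[symmetric] cong: conj_cong bex_cong)
qed

section \<open>Poisson derivations as two-by-two matrices\<close>

definition assemble :: "('a \<Rightarrow> 'a) \<Rightarrow> ('a \<Rightarrow> 'b) \<Rightarrow> ('b \<Rightarrow> 'b) \<Rightarrow> ('b \<Rightarrow> 'a) \<Rightarrow> 'a \<times> 'b \<Rightarrow> 'a \<times> 'b" where
  "assemble l q L T = (\<lambda>x\<in>carrier (P0 \<ltimes> P1).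
    (l (fst x) \<oplus>\<^bsub>P0\<^esub> T (snd x), q (fst x) \<oplus>\<^bsub>P1\<^esub> L (snd x)))"

text \<open>The conditions on \<open>l\<close>, \<open>q\<close> and \<open>L\<close> account for
  all terms without \<open>T\<close>. In the P1-part, \<open>T\<close> leaves T(\<xi>) \<eta> +
  T(\<eta>) \<xi> in the product rule and \<open>nabla (T \<eta>) \<xi>\<close> minus
  \<open>nabla (T \<xi>) \<eta>\<close> in the bracket rule; the two conditions of
  \<open>skew_equivariant\<close> on pairs \<eta>, \<xi> make these vanish. In the P0-part, the
  terms of \<open>T\<close> match by P0-linearity and equivariance.\<close>

lemma assemble_Poiss:
  assumes l: "l \<in> Poiss R P0 br0" and q: "cocycle1 q" and L: "lifts L l" and T: "skew_equivariant T"
  shows "assemble l q L T \<in> Poiss R (P0 \<ltimes> P1) br"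
proof -
  note l1 = A.PoissD[OF l]
  note l2 = module_homD[OF l1(2)]
  have qd: "q \<in> derivations R P0 P1"
    using q by (simp add: cocycle1_def)
  then have "q \<in> module_hom R P0 (restrict_scalars P0 P1)"
    by (simp add: derivations_def)
  note q2 = module_homD[OF this, simplified]
  have q3: "q (f \<otimes>\<^bsub>P0\<^esub> g) = f \<odot>\<^bsub>P1\<^esub> q g \<oplus>\<^bsub>P1\<^esub> g \<odot>\<^bsub>P1\<^esub> q f"
    "q (br0 f g) = nabla f (q g) \<ominus>\<^bsub>P1\<^esub> nabla g (q f)" if "f \<in> carrier P0" "g \<in> carrier P0" for f g
    using qd q that by (auto simp: derivations_def cocycle1_def)
  have "L \<in> module_hom R (restrict_scalars P0 P1) (restrict_scalars P0 P1)"
    using L by (simp add: lifts_def)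
  note L2 = module_homD[OF this, simplified]
    and Lm = module_hom_minus[OF this restricted_module restricted_module, simplified, unfolded restrict_scalars_inv]
  have L3: "L (f \<odot>\<^bsub>P1\<^esub> \<eta>) = f \<odot>\<^bsub>P1\<^esub> L \<eta> \<oplus>\<^bsub>P1\<^esub> l f \<odot>\<^bsub>P1\<^esub> \<eta>"
    "L (nabla f \<eta>) = nabla f (L \<eta>) \<oplus>\<^bsub>P1\<^esub> nabla (l f) \<eta>" if "f \<in> carrier P0" "\<eta> \<in> carrier P1" for f \<eta>
    using L that by (auto simp: lifts_def)
  have "T \<in> module_hom P0 P1 (self_module P0)"
    using T by (simp add: skew_equivariant_def)
  note T2 = module_homD[OF this, unfolded self_module_def, simplified]
  have Tm: "T (\<ominus>\<^bsub>P1\<^esub> \<eta>) = \<ominus>\<^bsub>P0\<^esub> T \<eta>" if "\<eta> \<in> carrier P1" for \<eta>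
  proof -
    have "T \<zero>\<^bsub>P1\<^esub> \<oplus>\<^bsub>P0\<^esub> T \<zero>\<^bsub>P1\<^esub> = T \<zero>\<^bsub>P1\<^esub>"
      using T2(2)[of "\<zero>\<^bsub>P1\<^esub>" "\<zero>\<^bsub>P1\<^esub>"] by simp
    then have "T \<zero>\<^bsub>P1\<^esub> = \<zero>\<^bsub>P0\<^esub>"
      using T2(1)[of "\<zero>\<^bsub>P1\<^esub>"] by (metis A.M.add.l_cancel_one V.M.zero_closed)
    then have "T (\<ominus>\<^bsub>P1\<^esub> \<eta>) \<oplus>\<^bsub>P0\<^esub> T \<eta> = \<zero>\<^bsub>P0\<^esub>"
      using T2(2)[of "\<ominus>\<^bsub>P1\<^esub> \<eta>" \<eta>] that by (simp add: V.M.l_neg)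
    then show ?thesis
      using T2(1) that by (metis A.M.minus_equality V.M.a_inv_closed)
  qed
  have T3: "T \<xi> \<odot>\<^bsub>P1\<^esub> \<eta> \<oplus>\<^bsub>P1\<^esub> T \<eta> \<odot>\<^bsub>P1\<^esub> \<xi> = \<zero>\<^bsub>P1\<^esub>" "nabla (T \<eta>) \<xi> = nabla (T \<xi>) \<eta>"
    if "\<eta> \<in> carrier P1" "\<xi> \<in> carrier P1" for \<eta> \<xi>
    using T that by (auto simp: skew_equivariant_def)
  have T4: "T (nabla f \<eta>) = br0 f (T \<eta>)" if "f \<in> carrier P0" "\<eta> \<in> carrier P1" for f \<eta>
    using T that by (auto simp: skew_equivariant_def)
  have T5: "T (r \<odot>\<^bsub>P0\<^esub> \<one>\<^bsub>P0\<^esub> \<odot>\<^bsub>P1\<^esub> \<eta>) = r \<odot>\<^bsub>P0\<^esub> T \<eta>" if "r \<in> carrier R" "\<eta> \<in> carrier P1" for r \<eta>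
    using that by (simp add: T2 A.smult_assoc2)
  let ?X = "assemble l q L T"
  have X: "?X (f, \<eta>) = (l f \<oplus>\<^bsub>P0\<^esub> T \<eta>, q f \<oplus>\<^bsub>P1\<^esub> L \<eta>)" if "f \<in> carrier P0" "\<eta> \<in> carrier P1" for f \<eta>
    using that by (simp add: assemble_def)
  have mult: "?X ((f, \<eta>) \<otimes>\<^bsub>P0 \<ltimes> P1\<^esub> (g, \<xi>)) =
      (f, \<eta>) \<otimes>\<^bsub>P0 \<ltimes> P1\<^esub> ?X (g, \<xi>) \<oplus>\<^bsub>P0 \<ltimes> P1\<^esub> (g, \<xi>) \<otimes>\<^bsub>P0 \<ltimes> P1\<^esub> ?X (f, \<eta>)"
    if c: "f \<in> carrier P0" "\<eta> \<in> carrier P1" "g \<in> carrier P0" "\<xi> \<in> carrier P1" for f \<eta> g \<xi>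
  proof -
    let ?r = "(f \<odot>\<^bsub>P1\<^esub> q g \<oplus>\<^bsub>P1\<^esub> g \<odot>\<^bsub>P1\<^esub> q f) \<oplus>\<^bsub>P1\<^esub>
      ((f \<odot>\<^bsub>P1\<^esub> L \<xi> \<oplus>\<^bsub>P1\<^esub> l f \<odot>\<^bsub>P1\<^esub> \<xi>) \<oplus>\<^bsub>P1\<^esub> (g \<odot>\<^bsub>P1\<^esub> L \<eta> \<oplus>\<^bsub>P1\<^esub> l g \<odot>\<^bsub>P1\<^esub> \<eta>))"
    have "(f \<odot>\<^bsub>P1\<^esub> (q g \<oplus>\<^bsub>P1\<^esub> L \<xi>) \<oplus>\<^bsub>P1\<^esub> (l g \<oplus>\<^bsub>P0\<^esub> T \<xi>) \<odot>\<^bsub>P1\<^esub> \<eta>) \<oplus>\<^bsub>P1\<^esub>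
        (g \<odot>\<^bsub>P1\<^esub> (q f \<oplus>\<^bsub>P1\<^esub> L \<eta>) \<oplus>\<^bsub>P1\<^esub> (l f \<oplus>\<^bsub>P0\<^esub> T \<eta>) \<odot>\<^bsub>P1\<^esub> \<xi>) =
      ?r \<oplus>\<^bsub>P1\<^esub> (T \<xi> \<odot>\<^bsub>P1\<^esub> \<eta> \<oplus>\<^bsub>P1\<^esub> T \<eta> \<odot>\<^bsub>P1\<^esub> \<xi>)"
      using c by (simp add: V.smult_r_distr V.smult_l_distr V.M.a_ac q2(1) L2(1) l2(1) T2(1))
    also have "\<dots> = ?r"
      using c by (simp add: T3(1) q2(1) L2(1) l2(1) T2(1))
    finally have s: "(f \<odot>\<^bsub>P1\<^esub> (q g \<oplus>\<^bsub>P1\<^esub> L \<xi>) \<oplus>\<^bsub>P1\<^esub> (l g \<oplus>\<^bsub>P0\<^esub> T \<xi>) \<odot>\<^bsub>P1\<^esub> \<eta>) \<oplus>\<^bsub>P1\<^esub>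
        (g \<odot>\<^bsub>P1\<^esub> (q f \<oplus>\<^bsub>P1\<^esub> L \<eta>) \<oplus>\<^bsub>P1\<^esub> (l f \<oplus>\<^bsub>P0\<^esub> T \<eta>) \<odot>\<^bsub>P1\<^esub> \<xi>) = ?r" .
    have t: "f \<otimes>\<^bsub>P0\<^esub> (l g \<oplus>\<^bsub>P0\<^esub> T \<xi>) \<oplus>\<^bsub>P0\<^esub> g \<otimes>\<^bsub>P0\<^esub> (l f \<oplus>\<^bsub>P0\<^esub> T \<eta>) =
      l (f \<otimes>\<^bsub>P0\<^esub> g) \<oplus>\<^bsub>P0\<^esub> T (f \<odot>\<^bsub>P1\<^esub> \<xi> \<oplus>\<^bsub>P1\<^esub> g \<odot>\<^bsub>P1\<^esub> \<eta>)"
      using c by (simp add: l1(3) T2 l2(1) A.r_distr A.M.a_ac)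
    show ?thesis
      using c by (simp add: X s t q3(1) L2(2) L3(1) q2(1) L2(1) l2(1) T2(1))
  qed
  have brk: "?X (br (f, \<eta>) (g, \<xi>)) = br (?X (f, \<eta>)) (g, \<xi>) \<oplus>\<^bsub>P0 \<ltimes> P1\<^esub> br (f, \<eta>) (?X (g, \<xi>))"
    if c: "f \<in> carrier P0" "\<eta> \<in> carrier P1" "g \<in> carrier P0" "\<xi> \<in> carrier P1" for f \<eta> g \<xi>
  proof -
    let ?e = "nabla (T \<xi>) \<eta>"
    let ?r = "q (br0 f g) \<oplus>\<^bsub>P1\<^esub> L (nabla f \<xi> \<ominus>\<^bsub>P1\<^esub> nabla g \<eta>)"
    have "(nabla (l f \<oplus>\<^bsub>P0\<^esub> T \<eta>) \<xi> \<ominus>\<^bsub>P1\<^esub> nabla g (q f \<oplus>\<^bsub>P1\<^esub> L \<eta>)) \<oplus>\<^bsub>P1\<^esub>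
        (nabla f (q g \<oplus>\<^bsub>P1\<^esub> L \<xi>) \<ominus>\<^bsub>P1\<^esub> nabla (l g \<oplus>\<^bsub>P0\<^esub> T \<xi>) \<eta>) = ?r \<oplus>\<^bsub>P1\<^esub> (?e \<oplus>\<^bsub>P1\<^esub> \<ominus>\<^bsub>P1\<^esub> ?e)"
      using c T3(2)[of \<eta> \<xi>]
      by (simp add: nabla_add_left nabla_add_right a_minus_def V.M.minus_add V.M.a_ac q3(2)
          L2(1,2) L3(2) Lm q2(1) l2(1) T2(1) del: V.M.r_neg1 V.M.r_neg2)
    also have "\<dots> = ?r"
      using c by (simp add: V.M.r_neg q2(1) L2(1) T2(1))
    finally have s: "(nabla (l f \<oplus>\<^bsub>P0\<^esub> T \<eta>) \<xi> \<ominus>\<^bsub>P1\<^esub> nabla g (q f \<oplus>\<^bsub>P1\<^esub> L \<eta>)) \<oplus>\<^bsub>P1\<^esub>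
        (nabla f (q g \<oplus>\<^bsub>P1\<^esub> L \<xi>) \<ominus>\<^bsub>P1\<^esub> nabla (l g \<oplus>\<^bsub>P0\<^esub> T \<xi>) \<eta>) = ?r" .
    have t: "br0 (l f \<oplus>\<^bsub>P0\<^esub> T \<eta>) g \<oplus>\<^bsub>P0\<^esub> br0 f (l g \<oplus>\<^bsub>P0\<^esub> T \<xi>) =
      l (br0 f g) \<oplus>\<^bsub>P0\<^esub> T (nabla f \<xi> \<ominus>\<^bsub>P1\<^esub> nabla g \<eta>)"
      using c A.bracket_skew[of "T \<eta>" g]
      by (simp add: l1(4) T2(1,2) T4 Tm l2(1) A.bracket_add_left A.bracket_add_right a_minus_def A.M.a_ac)
    show ?thesis
      using c by (simp add: X s t bracket_nabla q2(1) L2(1) l2(1) T2(1))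
  qed
  have "?X \<in> module_hom R (P0 \<ltimes> P1) (P0 \<ltimes> P1)"
  proof (rule module_homI)
    fix x assume "x \<in> carrier (P0 \<ltimes> P1)"
    then show "?X x \<in> carrier (P0 \<ltimes> P1)"
      by (cases x) (auto simp: X l2(1) T2(1) q2(1) L2(1))
  next
    fix x y assume "x \<in> carrier (P0 \<ltimes> P1)" "y \<in> carrier (P0 \<ltimes> P1)"
    then show "?X (x \<oplus>\<^bsub>P0 \<ltimes> P1\<^esub> y) = ?X x \<oplus>\<^bsub>P0 \<ltimes> P1\<^esub> ?X y"
      by (cases x; cases y) (simp add: X l2(1,2) T2(1,2) q2(1,2) L2(1,2) A.M.a_ac V.M.a_ac)
  next
    fix r x assume "r \<in> carrier R" "x \<in> carrier (P0 \<ltimes> P1)"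
    then show "?X (r \<odot>\<^bsub>P0 \<ltimes> P1\<^esub> x) = r \<odot>\<^bsub>P0 \<ltimes> P1\<^esub> ?X x"
      by (cases x) (simp add: X l2 T2(1) T5 q2 L2 A.smult_r_distr V.smult_r_distr)
  qed
  moreover have "?X \<in> carrier (P0 \<ltimes> P1) \<rightarrow>\<^sub>E carrier (P0 \<ltimes> P1)"
    by (auto simp: assemble_def l2(1) T2(1) q2(1) L2(1))
  ultimately show ?thesis
    unfolding P.Poiss_iff using mult brk by (auto simp del: semidirect_simps(4))
qed

text \<open>Two elements (f, 0), (g, 0) give the conditions on \<open>l\<close> and
  \<open>q\<close>; a mixed pair gives linearity and equivariance of \<open>T\<close>, and the two
  conditions tying \<open>L\<close> to \<open>l\<close>. Elements (0, \<eta>), (0, \<xi>) have zero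
  product and zero bracket, and X of these zeros yields the remaining two conditions on
  \<open>T\<close>.\<close>

lemma Poiss_components:
  assumes X: "X \<in> Poiss R (P0 \<ltimes> P1) br"
  shows "(\<lambda>f\<in>carrier P0. fst (X (f, \<zero>\<^bsub>P1\<^esub>))) \<in> Poiss R P0 br0"
    and "cocycle1 (\<lambda>f. snd (X (f, \<zero>\<^bsub>P1\<^esub>)))"
    and "lifts (\<lambda>\<eta>\<in>carrier P1. snd (X (\<zero>\<^bsub>P0\<^esub>, \<eta>))) (\<lambda>f\<in>carrier P0. fst (X (f, \<zero>\<^bsub>P1\<^esub>)))"
    and "skew_equivariant (\<lambda>\<eta>\<in>carrier P1. fst (X (\<zero>\<^bsub>P0\<^esub>, \<eta>)))"
proof -
  note X1 = P.PoissD[OF X]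
  note X2 = module_homD[OF X1(2)]
  define l q T L where "l f = fst (X (f, \<zero>\<^bsub>P1\<^esub>))" and "q f = snd (X (f, \<zero>\<^bsub>P1\<^esub>))"
    and "T \<eta> = fst (X (\<zero>\<^bsub>P0\<^esub>, \<eta>))" and "L \<eta> = snd (X (\<zero>\<^bsub>P0\<^esub>, \<eta>))" for f \<eta>
  have Xf: "X (f, \<zero>\<^bsub>P1\<^esub>) = (l f, q f)" and X\<eta>: "X (\<zero>\<^bsub>P0\<^esub>, \<eta>) = (T \<eta>, L \<eta>)" for f \<eta>
    by (simp_all add: l_def q_def T_def L_def)
  have c: "f \<in> carrier P0 \<Longrightarrow> l f \<in> carrier P0" "f \<in> carrier P0 \<Longrightarrow> q f \<in> carrier P1"
    "\<eta> \<in> carrier P1 \<Longrightarrow> T \<eta> \<in> carrier P0" "\<eta> \<in> carrier P1 \<Longrightarrow> L \<eta> \<in> carrier P1" for f \<eta>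
    using X2(1)[of "(f, \<zero>\<^bsub>P1\<^esub>)"] X2(1)[of "(\<zero>\<^bsub>P0\<^esub>, \<eta>)"] by (auto simp: Xf X\<eta>)
  have add0: "l (f \<oplus>\<^bsub>P0\<^esub> g) = l f \<oplus>\<^bsub>P0\<^esub> l g" "q (f \<oplus>\<^bsub>P0\<^esub> g) = q f \<oplus>\<^bsub>P1\<^esub> q g"
    if "f \<in> carrier P0" "g \<in> carrier P0" for f g
    using X2(2)[of "(f, \<zero>\<^bsub>P1\<^esub>)" "(g, \<zero>\<^bsub>P1\<^esub>)"] that by (auto simp: Xf)
  have add1: "T (\<eta> \<oplus>\<^bsub>P1\<^esub> \<xi>) = T \<eta> \<oplus>\<^bsub>P0\<^esub> T \<xi>" "L (\<eta> \<oplus>\<^bsub>P1\<^esub> \<xi>) = L \<eta> \<oplus>\<^bsub>P1\<^esub> L \<xi>"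
    if "\<eta> \<in> carrier P1" "\<xi> \<in> carrier P1" for \<eta> \<xi>
    using X2(2)[of "(\<zero>\<^bsub>P0\<^esub>, \<eta>)" "(\<zero>\<^bsub>P0\<^esub>, \<xi>)"] that by (auto simp: X\<eta>)
  have smult0: "l (r \<odot>\<^bsub>P0\<^esub> f) = r \<odot>\<^bsub>P0\<^esub> l f" "q (r \<odot>\<^bsub>P0\<^esub> f) = (r \<odot>\<^bsub>P0\<^esub> \<one>\<^bsub>P0\<^esub>) \<odot>\<^bsub>P1\<^esub> q f"
    if "r \<in> carrier R" "f \<in> carrier P0" for r f
    using X2(3)[of r "(f, \<zero>\<^bsub>P1\<^esub>)"] that by (auto simp: Xf)
  have smult1: "L ((r \<odot>\<^bsub>P0\<^esub> \<one>\<^bsub>P0\<^esub>) \<odot>\<^bsub>P1\<^esub> \<eta>) = (r \<odot>\<^bsub>P0\<^esub> \<one>\<^bsub>P0\<^esub>) \<odot>\<^bsub>P1\<^esub> L \<eta>" if "r \<in> carrier R" "\<eta> \<in> carrier P1" for r \<eta>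
    using X2(3)[of r "(\<zero>\<^bsub>P0\<^esub>, \<eta>)"] that by (auto simp: X\<eta>)
  have mult00: "l (f \<otimes>\<^bsub>P0\<^esub> g) = f \<otimes>\<^bsub>P0\<^esub> l g \<oplus>\<^bsub>P0\<^esub> g \<otimes>\<^bsub>P0\<^esub> l f"
      "q (f \<otimes>\<^bsub>P0\<^esub> g) = f \<odot>\<^bsub>P1\<^esub> q g \<oplus>\<^bsub>P1\<^esub> g \<odot>\<^bsub>P1\<^esub> q f"
    if "f \<in> carrier P0" "g \<in> carrier P0" for f g
    using X1(3)[of "(f, \<zero>\<^bsub>P1\<^esub>)" "(g, \<zero>\<^bsub>P1\<^esub>)"] that by (auto simp: Xf c)
  have mult01: "T (f \<odot>\<^bsub>P1\<^esub> \<eta>) = f \<otimes>\<^bsub>P0\<^esub> T \<eta>" "L (f \<odot>\<^bsub>P1\<^esub> \<eta>) = f \<odot>\<^bsub>P1\<^esub> L \<eta> \<oplus>\<^bsub>P1\<^esub> l f \<odot>\<^bsub>P1\<^esub> \<eta>"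
    if "f \<in> carrier P0" "\<eta> \<in> carrier P1" for f \<eta>
    using X1(3)[of "(f, \<zero>\<^bsub>P1\<^esub>)" "(\<zero>\<^bsub>P0\<^esub>, \<eta>)"] that by (auto simp: Xf X\<eta> c)
  \<comment> \<open>Needed for pairs (0, \<eta>), (0, \<xi>), whose product and bracket are both
    zero.\<close>
  have X0: "X (\<zero>\<^bsub>P0\<^esub>, \<zero>\<^bsub>P1\<^esub>) = (\<zero>\<^bsub>P0\<^esub>, \<zero>\<^bsub>P1\<^esub>)"
    using module_hom_zero[OF X1(2) P.module_axioms P.module_axioms] by simp
  have mult11: "T \<xi> \<odot>\<^bsub>P1\<^esub> \<eta> \<oplus>\<^bsub>P1\<^esub> T \<eta> \<odot>\<^bsub>P1\<^esub> \<xi> = \<zero>\<^bsub>P1\<^esub>" if "\<eta> \<in> carrier P1" "\<xi> \<in> carrier P1" for \<eta> \<xi>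
    using X1(3)[of "(\<zero>\<^bsub>P0\<^esub>, \<eta>)" "(\<zero>\<^bsub>P0\<^esub>, \<xi>)"] that by (simp add: X0[unfolded X\<eta>] X\<eta> c)
  have br00: "l (br0 f g) = br0 (l f) g \<oplus>\<^bsub>P0\<^esub> br0 f (l g)"
      "q (br0 f g) = nabla f (q g) \<ominus>\<^bsub>P1\<^esub> nabla g (q f)"
    if "f \<in> carrier P0" "g \<in> carrier P0" for f g
    using X1(4)[of "(f, \<zero>\<^bsub>P1\<^esub>)" "(g, \<zero>\<^bsub>P1\<^esub>)"] that
    by (auto simp: Xf c bracket_nabla a_minus_def V.M.a_ac)
  have br01: "T (nabla f \<eta>) = br0 f (T \<eta>)" "L (nabla f \<eta>) = nabla f (L \<eta>) \<oplus>\<^bsub>P1\<^esub> nabla (l f) \<eta>"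
    if "f \<in> carrier P0" "\<eta> \<in> carrier P1" for f \<eta>
    using X1(4)[of "(f, \<zero>\<^bsub>P1\<^esub>)" "(\<zero>\<^bsub>P0\<^esub>, \<eta>)"] that
    by (auto simp: Xf X\<eta> c bracket_nabla a_minus_def A.bracket_zero_right V.M.a_ac)
  have br11: "nabla (T \<eta>) \<xi> = nabla (T \<xi>) \<eta>" if "\<eta> \<in> carrier P1" "\<xi> \<in> carrier P1" for \<eta> \<xi>
  proof -
    have "nabla (T \<eta>) \<xi> \<ominus>\<^bsub>P1\<^esub> nabla (T \<xi>) \<eta> = \<zero>\<^bsub>P1\<^esub>"
      using X1(4)[of "(\<zero>\<^bsub>P0\<^esub>, \<eta>)" "(\<zero>\<^bsub>P0\<^esub>, \<xi>)"] that
      by (simp add: X0[unfolded X\<eta>, simplified] X\<eta> c bracket_nabla a_minus_def A.bracket_zero_right A.bracket_zero_left)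
    then show ?thesis
      using that c V.M.diff_eq_zero_iff by simp
  qed
  show "(\<lambda>f\<in>carrier P0. fst (X (f, \<zero>\<^bsub>P1\<^esub>))) \<in> Poiss R P0 br0"
    unfolding l_def[symmetric] A.Poiss_iff
    by (auto simp: c add0 smult0 mult00 br00 intro!: module_homI)
  show "cocycle1 (\<lambda>f. snd (X (f, \<zero>\<^bsub>P1\<^esub>)))"
    unfolding q_def[symmetric] cocycle1_def derivations_def
    by (auto simp: c add0 smult0 mult00 br00 intro!: module_homI)
  show "lifts (\<lambda>\<eta>\<in>carrier P1. snd (X (\<zero>\<^bsub>P0\<^esub>, \<eta>))) (\<lambda>f\<in>carrier P0. fst (X (f, \<zero>\<^bsub>P1\<^esub>)))"
    unfolding l_def[symmetric] L_def[symmetric] lifts_def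
    by (intro conjI module_homI) (auto simp: c add1 smult1, auto simp: c mult01 br01)
  show "skew_equivariant (\<lambda>\<eta>\<in>carrier P1. fst (X (\<zero>\<^bsub>P0\<^esub>, \<eta>)))"
    unfolding T_def[symmetric] skew_equivariant_def
    by (auto simp: c add1 mult01 br01 mult11 self_module_def intro!: module_homI br11)
qed

lemma Poiss_eq_components:
  assumes X: "X \<in> Poiss R (P0 \<ltimes> P1) br" and "f \<in> carrier P0" "\<eta> \<in> carrier P1"
  shows "X (f, \<eta>) = X (f, \<zero>\<^bsub>P1\<^esub>) \<oplus>\<^bsub>P0 \<ltimes> P1\<^esub> X (\<zero>\<^bsub>P0\<^esub>, \<eta>)"
  using module_homD(2)[OF P.PoissD(2)[OF X], of "(f, \<zero>\<^bsub>P1\<^esub>)" "(\<zero>\<^bsub>P0\<^esub>, \<eta>)"] assms(2,3) by simp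

text \<open>The same map obeys a Leibniz rule with symbol \<open>l\<close> and, being D_df, one with
  symbol {f, .}_0. The difference of the symbols annihilates \<open>P1\<close> and is zero by
  faithfulness.\<close>

lemma lift_of_nabla:
  assumes f: "f \<in> carrier P0" and l: "l \<in> Poiss R P0 br0"
    and L: "lifts L l" "\<And>\<eta>. \<eta> \<in> carrier P1 \<Longrightarrow> L \<eta> = nabla f \<eta>" and g: "g \<in> carrier P0"
  shows "l g = br0 f g"
proof -
  have c: "l g \<in> carrier P0" "br0 f g \<in> carrier P0"
    using A.PoissD(1)[OF l] f g by auto
  have "(l g \<ominus>\<^bsub>P0\<^esub> br0 f g) \<odot>\<^bsub>P1\<^esub> \<eta> = \<zero>\<^bsub>P1\<^esub>" if \<eta>: "\<eta> \<in> carrier P1" for \<eta>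
  proof -
    have "g \<odot>\<^bsub>P1\<^esub> nabla f \<eta> \<oplus>\<^bsub>P1\<^esub> l g \<odot>\<^bsub>P1\<^esub> \<eta> = g \<odot>\<^bsub>P1\<^esub> nabla f \<eta> \<oplus>\<^bsub>P1\<^esub> br0 f g \<odot>\<^bsub>P1\<^esub> \<eta>"
      using L g \<eta> f nabla_leibniz[OF f g \<eta>] by (simp add: lifts_def)
    then have "l g \<odot>\<^bsub>P1\<^esub> \<eta> = br0 f g \<odot>\<^bsub>P1\<^esub> \<eta>"
      using c \<eta> f g by (metis V.M.a_comm V.M.add.right_cancel V.smult_closed nabla_closed)
    then show ?thesis
      using c \<eta> by (simp add: a_minus_def V.smult_l_distr V.smult_l_minus V.M.r_neg)
  qed
  then show ?thesis
    using faithful[of "l g \<ominus>\<^bsub>P0\<^esub> br0 f g"] A.M.diff_eq_zero_iff c by blast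
qed

section \<open>The three component maps and their joint surjectivity\<close>

abbreviation (input) "base_to_module X \<equiv> \<lambda>fs\<in>tuples P0 1. snd (X (fs ! 0, \<zero>\<^bsub>P1\<^esub>))"
abbreviation (input) "module_to_module X \<equiv> \<lambda>\<eta>\<in>carrier P1. snd (X (\<zero>\<^bsub>P0\<^esub>, \<eta>))"
abbreviation (input) "module_to_base X \<equiv> \<lambda>\<eta>\<in>carrier P1. fst (X (\<zero>\<^bsub>P0\<^esub>, \<eta>))"

lemma nth_tuples_1: "fs \<in> tuples P0 1 \<Longrightarrow> fs ! 0 \<in> carrier P0"
  by (auto simp: tuples_simps(2) simp del: One_nat_def)

lemma cocycle1_cong:
  assumes "\<And>f. f \<in> carrier P0 \<Longrightarrow> q f = q' f"
  shows "cocycle1 q \<longleftrightarrow> cocycle1 q'"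
  using assms derivations_cong[of q q'] by (simp add: cocycle1_def)

lemma base_to_module_hom:
  "(\<lambda>X. base_to_module X) \<in> module_hom R P.Poiss_module (cocycles R P0 br0 P1 D 1)"
proof (rule module_homI)
  fix X assume X: "X \<in> carrier P.Poiss_module"
  then have c: "cocycle1 (\<lambda>f. snd (X (f, \<zero>\<^bsub>P1\<^esub>)))"
    using Poiss_components(2) by simp
  then have "cocycle1 (\<lambda>f. base_to_module X [f])"
    by (subst cocycle1_cong[where q' = "\<lambda>f. snd (X (f, \<zero>\<^bsub>P1\<^esub>))"]) (auto simp: tuples_def)
  moreover have "snd (X (f, \<zero>\<^bsub>P1\<^esub>)) \<in> carrier P1" if "f \<in> carrier P0" for f
    using c that by (auto simp: cocycle1_def derivations_def module_hom_def)
  ultimately show "base_to_module X \<in> carrier (cocycles R P0 br0 P1 D 1)"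
    unfolding cocycles_1_iff using nth_tuples_1 by auto
qed (auto simp: cocycles_def multiderivations_def fun_module_def fun_eq_iff nth_tuples_1[simplified])

lemma module_to_module_hom:
  "(\<lambda>X. module_to_module X) \<in> module_hom R P.Poiss_module (M_tilde R P0 br0 P1 D)"
proof (rule module_homI)
  fix X assume "X \<in> carrier P.Poiss_module"
  then have X: "X \<in> Poiss R (P0 \<ltimes> P1) br"
    by simp
  have "snd (X (\<zero>\<^bsub>P0\<^esub>, \<eta>)) \<in> carrier P1" if "\<eta> \<in> carrier P1" for \<eta>
    using PiE_mem[OF P.PoissD(1)[OF X], of "(\<zero>\<^bsub>P0\<^esub>, \<eta>)"] that by auto
  then have "module_to_module X \<in> carrier P1 \<rightarrow>\<^sub>E carrier P1"
    by (simp add: restrict_PiE_iff)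
  then show "module_to_module X \<in> carrier (M_tilde R P0 br0 P1 D)"
    unfolding M_tilde_iff using Poiss_components(1,3)[OF X] by fast
qed (auto simp: M_tilde_def fun_module_def fun_eq_iff)

lemma module_to_base_hom:
  "(\<lambda>X. module_to_base X) \<in> module_hom R P.Poiss_module (E_module R P0 br0 P1 D)"
proof (rule module_homI)
  fix X assume "X \<in> carrier P.Poiss_module"
  then have X: "X \<in> Poiss R (P0 \<ltimes> P1) br"
    by simp
  have "fst (X (\<zero>\<^bsub>P0\<^esub>, \<eta>)) \<in> carrier P0" if "\<eta> \<in> carrier P1" for \<eta>
    using PiE_mem[OF P.PoissD(1)[OF X], of "(\<zero>\<^bsub>P0\<^esub>, \<eta>)"] that by auto
  then have "module_to_base X \<in> carrier P1 \<rightarrow>\<^sub>E carrier P0"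
    by (simp add: restrict_PiE_iff)
  then show "module_to_base X \<in> carrier (E_module R P0 br0 P1 D)"
    unfolding E_module_iff using Poiss_components(4)[OF X] by (rule conjI)
qed (auto simp: E_module_def fun_module_def fun_eq_iff)

text \<open>The fourth entry \<open>l\<close> of the matrix is the symbol that membership of
  \<open>L\<close> in \<open>M_tilde\<close> provides.\<close>

lemma components_onto:
  assumes Q: "Q \<in> carrier (cocycles R P0 br0 P1 D 1)"
    and L: "L \<in> carrier (M_tilde R P0 br0 P1 D)" and T: "T \<in> carrier (E_module R P0 br0 P1 D)"
  shows "\<exists>X\<in>carrier P.Poiss_module. base_to_module X = Q \<and> module_to_module X = L \<and> module_to_base X = T"
proof -
  obtain l where l: "l \<in> Poiss R P0 br0" "lifts L l"
    using L by (auto simp: M_tilde_iff)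
  have Q': "Q \<in> tuples P0 1 \<rightarrow>\<^sub>E carrier P1" "cocycle1 (\<lambda>f. Q [f])"
    using Q by (auto simp: cocycles_1_iff simp del: One_nat_def)
  have T': "T \<in> carrier P1 \<rightarrow>\<^sub>E carrier P0" "skew_equivariant T"
    using T by (auto simp: E_module_iff)
  have L': "L \<in> carrier P1 \<rightarrow>\<^sub>E carrier P1"
    using L by (auto simp: M_tilde_iff)
  let ?X = "assemble l (\<lambda>f. Q [f]) L T"
  have X: "?X \<in> Poiss R (P0 \<ltimes> P1) br"
    by (rule assemble_Poiss[OF l(1) Q'(2) l(2) T'(2)])
  \<comment> \<open>The assembled map has P1-part q f + L 0 at (f, 0), and parts l 0 + T \<eta> and
    q 0 + L \<eta> at (0, \<eta>). The values at zero must vanish for the given components to be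
    recovered.\<close>
  have L0: "L \<zero>\<^bsub>P1\<^esub> = \<zero>\<^bsub>P1\<^esub>"
    using module_hom_zero[of L, OF _ restricted_module restricted_module] l(2) by (simp add: lifts_def)
  have Q0: "Q [\<zero>\<^bsub>P0\<^esub>] = \<zero>\<^bsub>P1\<^esub>"
    using module_hom_zero[of "\<lambda>f. Q [f]", OF _ A.module_axioms restricted_module] Q'(2)
    by (simp add: cocycle1_def derivations_def)
  have l0: "l \<zero>\<^bsub>P0\<^esub> = \<zero>\<^bsub>P0\<^esub>"
    by (rule module_hom_zero[OF A.PoissD(2)[OF l(1)] A.module_axioms A.module_axioms])
  have mem: "Q [f] \<in> carrier P1" if "f \<in> carrier P0" for f
    using Q'(1) that by (auto simp: tuples_def)
  have "base_to_module ?X = Q"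
  proof
    fix fs show "base_to_module ?X fs = Q fs"
    proof (cases "fs \<in> tuples P0 1")
      case True
      then obtain f where "fs = [f]" "f \<in> carrier P0"
        by (auto simp: tuples_simps(2) simp del: One_nat_def)
      then show ?thesis
        using True by (simp add: assemble_def L0 mem)
    next
      case False
      then show ?thesis
        using Q'(1) by (auto simp: PiE_iff extensional_def simp del: One_nat_def)
    qed
  qed
  moreover have "module_to_module ?X = L"
    using L' PiE_mem[OF L'] by (auto simp: assemble_def Q0 fun_eq_iff PiE_iff extensional_def)
  moreover have "module_to_base ?X = T"
    using T'(1) PiE_mem[OF T'(1)] by (auto simp: assemble_def l0 fun_eq_iff PiE_iff extensional_def)
  ultimately show ?thesis
    using X by auto
qed

section \<open>Hamiltonian derivations in components\<close>

lemma components_of_hamiltonian: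
  assumes "g \<in> carrier P0" "\<xi> \<in> carrier P1"
  shows "base_to_module (\<lambda>x\<in>carrier (P0 \<ltimes> P1). br (g, \<xi>) x) = (\<lambda>fs\<in>tuples P0 1. nabla (fs ! 0) (\<ominus>\<^bsub>P1\<^esub> \<xi>))"
    and "module_to_module (\<lambda>x\<in>carrier (P0 \<ltimes> P1). br (g, \<xi>) x) = (\<lambda>\<eta>\<in>carrier P1. nabla g \<eta>)"
    and "module_to_base (\<lambda>x\<in>carrier (P0 \<ltimes> P1). br (g, \<xi>) x) = (\<lambda>\<eta>\<in>carrier P1. \<zero>\<^bsub>P0\<^esub>)"
  \<comment> \<open>The P1-part of {(g, \<xi>), (f, 0)} is - D_df \<xi>; linearity moves the sign
    inside, which makes it the coboundary of - \<xi>.\<close>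
  using assms nth_tuples_1
  by (auto simp: bracket_nabla A.bracket_zero_right a_minus_def nabla_minus_right fun_eq_iff simp del: One_nat_def)

lemma C_inner_eq: "C_inner R P0 P1 D = (\<lambda>g. \<lambda>\<eta>\<in>carrier P1. nabla g \<eta>) ` carrier P0"
  by (auto simp: C_inner_def nabla_def)

lemma Ham_eq: "Ham (P0 \<ltimes> P1) br =
    (\<lambda>(g, \<xi>). \<lambda>x\<in>carrier (P0 \<ltimes> P1). br (g, \<xi>) x) ` (carrier P0 \<times> carrier P1)"
  unfolding P.Ham_eq_image by auto

text \<open>For the converse, g is read off the map on \<open>P1\<close> and \<xi> off the cochain,
  independently of each other. The P0-part on (f, 0) is not among the three conditions;
  \<open>lift_of_nabla\<close> forces it to be {g, f}_0.\<close>

lemma Ham_iff: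
  assumes X: "X \<in> Poiss R (P0 \<ltimes> P1) br"
  shows "X \<in> Ham (P0 \<ltimes> P1) br \<longleftrightarrow> base_to_module X \<in> coboundaries R P0 br0 P1 D 1 \<and>
    module_to_module X \<in> C_inner R P0 P1 D \<and> module_to_base X = (\<lambda>\<eta>\<in>carrier P1. \<zero>\<^bsub>P0\<^esub>)"
proof
  assume "X \<in> Ham (P0 \<ltimes> P1) br"
  then obtain g \<xi> where "g \<in> carrier P0" "\<xi> \<in> carrier P1" "X = (\<lambda>x\<in>carrier (P0 \<ltimes> P1). br (g, \<xi>) x)"
    by (auto simp: Ham_eq)
  then show "base_to_module X \<in> coboundaries R P0 br0 P1 D 1 \<and>
    module_to_module X \<in> C_inner R P0 P1 D \<and> module_to_base X = (\<lambda>\<eta>\<in>carrier P1. \<zero>\<^bsub>P0\<^esub>)"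
    using components_of_hamiltonian[of g \<xi>] unfolding coboundaries_1 C_inner_eq by auto
next
  assume asm: "base_to_module X \<in> coboundaries R P0 br0 P1 D 1 \<and>
    module_to_module X \<in> C_inner R P0 P1 D \<and> module_to_base X = (\<lambda>\<eta>\<in>carrier P1. \<zero>\<^bsub>P0\<^esub>)"
  then obtain g \<xi> where g: "g \<in> carrier P0" "module_to_module X = (\<lambda>\<eta>\<in>carrier P1. nabla g \<eta>)"
    and \<xi>: "\<xi> \<in> carrier P1" "base_to_module X = (\<lambda>fs\<in>tuples P0 1. nabla (fs ! 0) \<xi>)"
    unfolding coboundaries_1 C_inner_eq by blast
  have X\<eta>: "X (\<zero>\<^bsub>P0\<^esub>, \<eta>) = (\<zero>\<^bsub>P0\<^esub>, nabla g \<eta>)" if "\<eta> \<in> carrier P1" for \<eta>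
    using fun_cong[OF g(2), of \<eta>] fun_cong[OF asm[THEN conjunct2, THEN conjunct2], of \<eta>] that
    by (simp add: prod_eq_iff)
  have Xf: "X (f, \<zero>\<^bsub>P1\<^esub>) = (br0 g f, nabla f \<xi>)" if f: "f \<in> carrier P0" for f
  proof -
    have "snd (X (f, \<zero>\<^bsub>P1\<^esub>)) = nabla f \<xi>"
      using fun_cong[OF \<xi>(2), of "[f]"] f by (simp add: tuples_def)
    moreover have "fst (X (f, \<zero>\<^bsub>P1\<^esub>)) = br0 g f"
      using lift_of_nabla[OF g(1) Poiss_components(1,3)[OF X] _ f] f X\<eta> by simp
    ultimately show ?thesis
      by (simp add: prod_eq_iff)
  qed
  \<comment> \<open>The generator carries - \<xi> because (g, \<xi>) itself would produce the
    coboundary of - \<xi>.\<close>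
  have "X (f, \<eta>) = br (g, \<ominus>\<^bsub>P1\<^esub> \<xi>) (f, \<eta>)" if "f \<in> carrier P0" "\<eta> \<in> carrier P1" for f \<eta>
    unfolding Poiss_eq_components[OF X that] using that g(1) \<xi>(1)
    by (simp add: Xf X\<eta> bracket_nabla a_minus_def nabla_minus_right V.M.a_ac)
  then have "X = (\<lambda>x\<in>carrier (P0 \<ltimes> P1). br (g, \<ominus>\<^bsub>P1\<^esub> \<xi>) x)"
    using P.PoissD(1)[OF X] by (auto simp: fun_eq_iff PiE_iff extensional_def)
  then show "X \<in> Ham (P0 \<ltimes> P1) br"
    using g(1) \<xi>(1) unfolding Ham_eq by force
qed

lemma base_to_module_Ham: "(\<lambda>X. base_to_module X) ` Ham (P0 \<ltimes> P1) br = coboundaries R P0 br0 P1 D 1"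
proof -
  have "(\<lambda>X. base_to_module X) ` Ham (P0 \<ltimes> P1) br =
      (\<lambda>(g, \<xi>). \<lambda>fs\<in>tuples P0 1. nabla (fs ! 0) (\<ominus>\<^bsub>P1\<^esub> \<xi>)) ` (carrier P0 \<times> carrier P1)"
    unfolding Ham_eq image_image
    by (intro image_cong refl) (clarify, rule components_of_hamiltonian(1))
  also have "\<dots> = (\<lambda>\<xi>. \<lambda>fs\<in>tuples P0 1. nabla (fs ! 0) \<xi>) ` (\<lambda>(g, \<xi>). \<ominus>\<^bsub>P1\<^esub> \<xi>) ` (carrier P0 \<times> carrier P1)"
    unfolding image_image by (intro image_cong refl) auto
  \<comment> \<open>Negation permutes \<open>P1\<close>, so the sign does not change the set of
    coboundaries.\<close>
  also have "(\<lambda>(g, \<xi>). \<ominus>\<^bsub>P1\<^esub> \<xi>) ` (carrier P0 \<times> carrier P1) = carrier P1"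
  proof
    show "carrier P1 \<subseteq> (\<lambda>(g, \<xi>). \<ominus>\<^bsub>P1\<^esub> \<xi>) ` (carrier P0 \<times> carrier P1)"
    proof
      fix \<xi> assume "\<xi> \<in> carrier P1"
      then show "\<xi> \<in> (\<lambda>(g, \<xi>). \<ominus>\<^bsub>P1\<^esub> \<xi>) ` (carrier P0 \<times> carrier P1)"
        by (intro image_eqI[of _ _ "(\<zero>\<^bsub>P0\<^esub>, \<ominus>\<^bsub>P1\<^esub> \<xi>)"]) auto
    qed
  qed auto
  finally show ?thesis
    unfolding coboundaries_1 .
qed

lemma module_to_module_Ham: "(\<lambda>X. module_to_module X) ` Ham (P0 \<ltimes> P1) br = C_inner R P0 P1 D"
proof -
  have "(\<lambda>X. module_to_module X) ` Ham (P0 \<ltimes> P1) br =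
      (\<lambda>(g, \<xi>). \<lambda>\<eta>\<in>carrier P1. nabla g \<eta>) ` (carrier P0 \<times> carrier P1)"
    unfolding Ham_eq image_image
    by (intro image_cong refl) (clarify, rule components_of_hamiltonian(2))
  \<comment> \<open>Every g occurs, for instance paired with \<xi> = 0.\<close>
  also have "\<dots> = C_inner R P0 P1 D"
    unfolding C_inner_eq using V.M.zero_closed by (force simp: image_iff)
  finally show ?thesis .
qed

theorem split_poisson_H1:
  "module_isomorphic R (poisson_H1 R (P0 \<ltimes> P1) br)
    (cohomology R P0 br0 P1 D 1 \<oplus>\<^bold>m
     quotient_module (M_tilde R P0 br0 P1 D) (C_inner R P0 P1 D) \<oplus>\<^bold>m
     E_module R P0 br0 P1 D)"
  unfolding poisson_H1_def cohomology_def
proof (rule quotient_isomorphic_direct_sum[OF P.Poiss_module P.Ham_submodule base_to_module_hom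
      module_to_module_hom module_to_base_hom components_onto _ _ _ base_to_module_Ham module_to_module_Ham])
  show "X \<in> Ham (P0 \<ltimes> P1) br \<longleftrightarrow> base_to_module X \<in> coboundaries R P0 br0 P1 D 1 \<and>
    module_to_module X \<in> C_inner R P0 P1 D \<and> module_to_base X = \<zero>\<^bsub>E_module R P0 br0 P1 D\<^esub>"
    if "X \<in> carrier P.Poiss_module" for X
    using Ham_iff[of X] that by (simp add: E_module_def fun_module_def)
qed (auto simp: fun_module_def cocycles_def multiderivations_def M_tilde_def E_module_def
    fun_eq_iff nth_tuples_1[simplified])

end

section \<open>The general case\<close>

text \<open>The generator representing df is supported in {f}, so it lies in the free module of
  finitely supported functions.\<close>

lemma kaehler_d_closed:
  assumes "cring A" "f \<in> carrier A"
  shows "kaehler_d R A f \<in> carrier (kaehler R A)"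
proof -
  interpret cring A by fact
  have "{h \<in> carrier A. free_gen A f h \<noteq> \<zero>\<^bsub>A\<^esub>} \<subseteq> {f}"
    by (auto simp: free_gen_def split: if_splits)
  then have "free_gen A f \<in> carrier (free_module A)"
    by (auto simp: free_module_def free_gen_def intro: finite_subset)
  then show ?thesis
    by (auto simp: kaehler_d_def kaehler_def quotient_module_def A_RCOSETS_def')
qed

theorem theorem8p16:
  fixes R :: "'r ring"
    and P0 :: "('r, 'a) module"
    and P1 :: "('a, 'b) module"
    and br0 :: "'a \<Rightarrow> 'a \<Rightarrow> 'a"
    and br :: "'a \<times> 'b \<Rightarrow> 'a \<times> 'b \<Rightarrow> 'a \<times> 'b"
    and D :: "('a \<Rightarrow> 'a) set \<Rightarrow> 'b \<Rightarrow> 'b"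
    and K :: "('a \<Rightarrow> 'a) set \<Rightarrow> ('a \<Rightarrow> 'a) set \<Rightarrow> 'b"
  assumes "admissible_poisson_algebra R P0 br0 P1 br"
    and "corresponding_triple R P0 br0 P1 br (\<lambda>_ _. \<zero>\<^bsub>P1\<^esub>) D K"
    and "cohomology_class R P0 br0 P1 D 2 (Delta R P0 K) = \<zero>\<^bsub>cohomology R P0 br0 P1 D 2\<^esub>"
  shows "module_isomorphic R (poisson_H1 R (P0 \<ltimes> P1) br)
    (cohomology R P0 br0 P1 D 1 \<oplus>\<^bold>m
     quotient_module (M_tilde R P0 br0 P1 D) (C_inner R P0 P1 D) \<oplus>\<^bold>m
     E_module R P0 br0 P1 D)"
proof -
  have P0: "poisson_algebra R P0 br0" and P1: "faithful_module P0 P1"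
    and P: "poisson_algebra R (P0 \<ltimes> P1) br"
    using assms(1) by (auto simp: admissible_poisson_algebra_def)
  interpret A: poisson_alg R P0 br0
    using P0 by unfold_locales
  interpret P: poisson_alg R "P0 \<ltimes> P1" br
    using P by unfold_locales
  interpret V: module P0 P1
    using P1 by (simp add: faithful_module_def)
  define N where "N = restrict_scalars P0 P1"
  have N: "module R N"
    unfolding N_def by (rule restrict_scalars_module[OF A.algebra_axioms V.module_axioms])
  define Dd where "Dd f = D (kaehler_d R P0 f)" for f
  define \<kappa> where "\<kappa> f g = K (kaehler_d R P0 f) (kaehler_d R P0 g)" for f g
  have d: "kaehler_d R P0 f \<in> carrier (kaehler R P0)" if "f \<in> carrier P0" for f
    by (rule kaehler_d_closed[OF A.M_cring that])
  have Dd_hom: "Dd f \<in> module_hom R N N" if "f \<in> carrier P0" for f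
    using assms(2) d[OF that]
    by (auto simp: corresponding_triple_def contravariant_derivative_def module_bilinear_def Dd_def N_def)
  note Dds = module_homD[OF Dd_hom, unfolded N_def, simplified]
  have Dd_zero: "Dd f \<zero>\<^bsub>P1\<^esub> = \<zero>\<^bsub>P1\<^esub>" if "f \<in> carrier P0" for f
    using module_hom_zero[OF Dd_hom[OF that] N N] by (simp add: N_def)
  have Dd_minus: "Dd f (\<ominus>\<^bsub>P1\<^esub> \<eta>) = \<ominus>\<^bsub>P1\<^esub> Dd f \<eta>" if "f \<in> carrier P0" "\<eta> \<in> carrier P1" for f \<eta>
    using module_hom_minus[OF Dd_hom[OF that(1)] N N, of \<eta>] that(2)
    by (simp add: N_def restrict_scalars_inv)
  have \<kappa>: "\<kappa> f g \<in> carrier P1" if "f \<in> carrier P0" "g \<in> carrier P0" for f g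
  proof -
    have "module_bilinear P0 (kaehler R P0) (kaehler R P0) P1 K"
      using assms(2) unfolding corresponding_triple_def by blast
    then show ?thesis
      using d[OF that(1)] d[OF that(2)] by (auto simp: module_bilinear_def module_hom_def \<kappa>_def)
  qed
  have br: "br (f, \<eta>) (g, \<xi>) = (br0 f g, (Dd f \<xi> \<ominus>\<^bsub>P1\<^esub> Dd g \<eta>) \<oplus>\<^bsub>P1\<^esub> \<kappa> f g)"
    if "f \<in> carrier P0" "\<eta> \<in> carrier P1" "g \<in> carrier P0" "\<xi> \<in> carrier P1" for f \<eta> g \<xi>
  proof -
    have "br (f, \<eta>) (g, \<xi>) = (br0 f g, (Dd f \<xi> \<ominus>\<^bsub>P1\<^esub> Dd g \<eta>) \<oplus>\<^bsub>P1\<^esub> \<zero>\<^bsub>P1\<^esub> \<oplus>\<^bsub>P1\<^esub> \<kappa> f g)"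
      using assms(2) that unfolding corresponding_triple_def Dd_def \<kappa>_def by blast
    then show ?thesis
      using that Dds by simp
  qed
  obtain Q where Q: "Q \<in> carrier (multiderivations R P0 P1 1)"
    and Delta_eq: "Delta R P0 K = differential R P0 br0 P1 D 1 Q"
  proof -
    \<comment> \<open>The hypothesis is an equality of cosets. To extract a primitive,
      \<open>Delta R P0 K\<close> must lie in its own coset, that is, zero must be a coboundary; it
      is the differential of the zero cochain. The coset equals the set of coboundaries, so the
      cocycle is one of them.\<close>
    let ?z = "\<lambda>fs\<in>tuples P0 1. \<zero>\<^bsub>P1\<^esub>"
    have z: "?z \<in> carrier (multiderivations R P0 P1 1)"
      unfolding multiderivations_1_iff
      by (auto simp: derivations_def tuples_def intro!: module_homI)
    have dz: "differential R P0 br0 P1 D 1 ?z [f, g] = \<zero>\<^bsub>P1\<^esub>" if "f \<in> carrier P0" "g \<in> carrier P0" for f g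
      using that by (subst differential_1)
        (auto simp: tuples_def Dd_def[symmetric] Dd_zero a_minus_def V.M.abelian_group_axioms)
    have cb: "coboundaries R P0 br0 P1 D 2 = differential R P0 br0 P1 D 1 ` carrier (multiderivations R P0 P1 1)"
      by (simp add: numeral_2_eq_2)
    have "Delta R P0 K = differential R P0 br0 P1 D 1 ?z \<oplus>\<^bsub>cocycles R P0 br0 P1 D 2\<^esub> Delta R P0 K"
      by (auto simp: cocycles_def multiderivations_def fun_module_def fun_eq_iff Delta_def tuples_simps(3)
          dz \<kappa>_def[symmetric] \<kappa> simp del: One_nat_def)
    then have "Delta R P0 K \<in> cohomology_class R P0 br0 P1 D 2 (Delta R P0 K)"
      unfolding cohomology_class_def a_r_coset_def' cb using z by blast
    then have "Delta R P0 K \<in> coboundaries R P0 br0 P1 D 2"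
      unfolding assms(3) by (simp add: cohomology_def quotient_module_def)
    then show ?thesis
      using that unfolding cb by blast
  qed
  define q where "q = (\<lambda>f. Q [f])"
  have "q \<in> module_hom R P0 N" "\<forall>f\<in>carrier P0. \<forall>g\<in>carrier P0. q (f \<otimes>\<^bsub>P0\<^esub> g) = f \<odot>\<^bsub>P1\<^esub> q g \<oplus>\<^bsub>P1\<^esub> g \<odot>\<^bsub>P1\<^esub> q f"
    using Q unfolding multiderivations_1_iff by (auto simp: derivations_def N_def q_def)
  note q = module_homD[OF this(1), unfolded N_def, simplified] this(2)[rule_format]
  have Q_eq: "Q [f] = q f" for f
    by (simp add: q_def)
  have \<kappa>_eq: "\<kappa> f g = Dd f (q g) \<ominus>\<^bsub>P1\<^esub> Dd g (q f) \<ominus>\<^bsub>P1\<^esub> q (br0 f g)"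
    if fg: "f \<in> carrier P0" "g \<in> carrier P0" for f g
  proof -
    have "\<kappa> f g = Delta R P0 K [f, g]"
      using fg by (simp add: Delta_def \<kappa>_def tuples_def)
    also have "\<dots> = D (kaehler_d R P0 f) (Q [g]) \<ominus>\<^bsub>P1\<^esub> D (kaehler_d R P0 g) (Q [f]) \<ominus>\<^bsub>P1\<^esub> Q [br0 f g]"
      unfolding Delta_eq by (rule differential_1[OF V.M.abelian_group_axioms fg])
        (use fg in \<open>auto simp: Dd_def[symmetric] Q_eq Dds q\<close>)
    finally show ?thesis
      by (simp add: Dd_def q_def)
  qed
  \<comment> \<open>The shear along q is multiplicative because q is a derivation. As for the sign,
    \<psi> in the arguments contributes - D_df(q g) + D_dg(q f) and \<phi> outside contributes q {f,
    g}_0, which together make - K(df, dg).\<close>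
  define \<phi> \<psi> where "\<phi> x = (fst x, snd x \<oplus>\<^bsub>P1\<^esub> q (fst x))" and "\<psi> x = (fst x, snd x \<ominus>\<^bsub>P1\<^esub> q (fst x))" for x
  define br' where "br' x y = \<phi> (br (\<psi> x) (\<psi> y))" for x y
  interpret T: poisson_transport R "P0 \<ltimes> P1" br \<phi> \<psi> br'
  proof
    show "\<phi> \<in> module_hom R (P0 \<ltimes> P1) (P0 \<ltimes> P1)" "\<psi> \<in> module_hom R (P0 \<ltimes> P1) (P0 \<ltimes> P1)"
      by (auto simp: \<phi>_def \<psi>_def q V.M.a_ac a_minus_def V.M.minus_add V.smult_r_distr V.smult_r_minus intro!: module_homI)
    show "\<phi> (x \<otimes>\<^bsub>P0 \<ltimes> P1\<^esub> y) = \<phi> x \<otimes>\<^bsub>P0 \<ltimes> P1\<^esub> \<phi> y"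
      if "x \<in> carrier (P0 \<ltimes> P1)" "y \<in> carrier (P0 \<ltimes> P1)" for x y
      using that by (cases x; cases y) (simp add: \<phi>_def q V.M.a_ac V.smult_r_distr)
  qed (auto simp: \<phi>_def \<psi>_def br'_def q a_minus_def V.M.a_assoc V.M.l_neg V.M.r_neg)
  interpret S: split_poisson R P0 P1 br0 br' D
  proof
    show "f = \<zero>\<^bsub>P0\<^esub>" if "f \<in> carrier P0" "\<And>\<eta>. \<eta> \<in> carrier P1 \<Longrightarrow> f \<odot>\<^bsub>P1\<^esub> \<eta> = \<zero>\<^bsub>P1\<^esub>" for f
      using P1 that by (auto simp: faithful_module_def)
    show "D (kaehler_d R P0 f) \<in> module_hom R (restrict_scalars P0 P1) (restrict_scalars P0 P1)"
      if "f \<in> carrier P0" for f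
      using Dd_hom[OF that] by (simp add: Dd_def N_def)
    show "br' (f, \<eta>) (g, \<xi>) = (br0 f g, D (kaehler_d R P0 f) \<xi> \<ominus>\<^bsub>P1\<^esub> D (kaehler_d R P0 g) \<eta>)"
      if c: "f \<in> carrier P0" "\<eta> \<in> carrier P1" "g \<in> carrier P0" "\<xi> \<in> carrier P1" for f \<eta> g \<xi>
    proof -
      have "Dd f (\<xi> \<ominus>\<^bsub>P1\<^esub> q g) \<ominus>\<^bsub>P1\<^esub> Dd g (\<eta> \<ominus>\<^bsub>P1\<^esub> q f) \<oplus>\<^bsub>P1\<^esub> \<kappa> f g \<oplus>\<^bsub>P1\<^esub> q (br0 f g) =
        Dd f \<xi> \<ominus>\<^bsub>P1\<^esub> Dd g \<eta>"
        using c V.M.cancel_shift[of "Dd f \<xi>" "Dd f (q g)" "Dd g \<eta>" "Dd g (q f)" "q (br0 f g)"]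
        by (simp add: \<kappa>_eq Dds Dd_minus q a_minus_def V.M.minus_add)
      then show ?thesis
        using c by (simp add: br'_def \<phi>_def \<psi>_def br q Dd_def)
    qed
  qed
  show ?thesis
    \<comment> \<open>The right-hand side is built from \<open>D\<close> and \<open>br0\<close>,
      which the shear leaves unchanged, so it is the same for \<open>br\<close> and
      \<open>br'\<close>.\<close>
    by (rule module_isomorphic_trans[OF T.poisson_H1_isomorphic S.split_poisson_H1])
qed

end
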